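(* Let $n>2$, let $N=\mathbb{R}P^{n+1}(c)$ be the real projective space of constant sectional curvature $c>0$ (elliptic space form), and let $M$ be an orientable quasi-umbilical hypersurface of $N$ with metric $g$, i.e. there are smooth functions $\alpha,\beta$ on $M$ and a $1$-form $\eta$ of norm $1$ such that the second fundamental form of $M$ is $h=\alpha g+\beta\,\eta\otimes\eta$. Let $\xi$ be the $g$-dual of $\eta$, and suppose that $\alpha\beta>0$. Then a Ricci soliton $(g,\xi,\lambda)$ on $M$ is shrinking, i.e. $\lambda<0$; and $M$ is a real homology sphere (all Betti numbers vanish) if it is also compact.
   Context: On a Riemannian manifold $(M,g)$ with curvature tensor $R$ and Ricci tensor $S(X,Y)=\mathrm{Tr}(Z\mapsto R(Z,X)Y)$, a Ricci soliton is a triple $(g,V,\lambda)$ with $V$ a vector field and $\lambda$ a real scalar such that $\mathcal{L}_Vg+2S+2\lambda g=0$, where $\mathcal{L}$ is the Lie derivative; it is shrinking, steady or expanding according as $\lambda$ is negative, zero or positive. *)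

theory Defs
  imports "HOL-Analysis.Analysis" "HOL-Homology.Homology"
begin

section \<open>Smooth maps between open subsets of Euclidean spaces\<close>

text \<open>Only used for open \<open>S\<close>; \<open>frechet_derivative f (at x) v\<close> is the directional
  derivative of \<open>f\<close> at \<open>x\<close> along \<open>v\<close>.\<close>

primrec Ck_on :: "nat \<Rightarrow> 'a::euclidean_space set \<Rightarrow> ('a \<Rightarrow> 'b::real_normed_vector) \<Rightarrow> bool" where
  "Ck_on 0 S f \<longleftrightarrow> continuous_on S f"
| "Ck_on (Suc k) S f \<longleftrightarrow>
     (\<forall>x\<in>S. f differentiable (at x)) \<and> (\<forall>v. Ck_on k S (\<lambda>x. frechet_derivative f (at x) v))"

definition smooth_on :: "'a::euclidean_space set \<Rightarrow> ('a \<Rightarrow> 'b::real_normed_vector) \<Rightarrow> bool" where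
  "smooth_on S f \<longleftrightarrow> (\<forall>k. Ck_on k S f)"


section \<open>Smooth manifolds\<close>

text \<open>A chart is a pair of its domain and its coordinate map.\<close>

type_synonym ('a, 'n) chart = "'a set \<times> ('a \<Rightarrow> real^'n)"

definition chart_image :: "('a, 'n) chart \<Rightarrow> (real^'n) set" where
  "chart_image c = snd c ` fst c"

definition param :: "('a, 'n) chart \<Rightarrow> real^'n \<Rightarrow> 'a" where
  "param c = inv_into (fst c) (snd c)"

definition is_chart :: "'a topology \<Rightarrow> ('a, 'n::finite) chart \<Rightarrow> bool" where
  "is_chart X c \<longleftrightarrow> openin X (fst c) \<and> open (chart_image c) \<and>
     homeomorphic_map (subtopology X (fst c)) (top_of_set (chart_image c)) (snd c)"

definition transition :: "('a, 'n) chart \<Rightarrow> ('a, 'n) chart \<Rightarrow> real^'n \<Rightarrow> real^'n" where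
  "transition c d = snd d \<circ> param c"

definition jacobian :: "('a, 'n::finite) chart \<Rightarrow> ('a, 'n) chart \<Rightarrow> 'a \<Rightarrow> real^'n \<Rightarrow> real^'n" where
  "jacobian c d p = frechet_derivative (transition c d) (at (snd c p))"

definition smooth_atlas :: "'a topology \<Rightarrow> ('a, 'n::finite) chart set \<Rightarrow> bool" where
  "smooth_atlas X A \<longleftrightarrow>
     (\<forall>c\<in>A. is_chart X c) \<and> (\<Union>c\<in>A. fst c) = topspace X \<and>
     (\<forall>c\<in>A. \<forall>d\<in>A. smooth_on (snd c ` (fst c \<inter> fst d)) (transition c d))"

text \<open>Tensor fields are given by their components in every chart of the atlas, as functions of
  the point of the manifold; the components in different charts are related by the
  Jacobians of the transition maps.\<close>

record ('a, 'n) rmfd =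
  top_of :: "'a topology"
  atlas_of :: "('a, 'n) chart set"
  metric_of :: "('a, 'n) chart \<Rightarrow> 'a \<Rightarrow> real^'n \<Rightarrow> real^'n \<Rightarrow> real"

text \<open>Manifolds are nonempty and connected, as usual in Riemannian geometry.\<close>

definition smooth_manifold :: "('a, 'n::finite) rmfd \<Rightarrow> bool" where
  "smooth_manifold M \<longleftrightarrow>
     Hausdorff_space (top_of M) \<and> second_countable (top_of M) \<and>
     connected_space (top_of M) \<and> topspace (top_of M) \<noteq> {} \<and>
     smooth_atlas (top_of M) (atlas_of M)"

definition orientable :: "('a, 'n::finite) rmfd \<Rightarrow> bool" where
  "orientable M \<longleftrightarrow>
     (\<exists>B. smooth_atlas (top_of M) B \<and> smooth_atlas (top_of M) (atlas_of M \<union> B) \<and>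
        (\<forall>c\<in>B. \<forall>d\<in>B. \<forall>p\<in>fst c \<inter> fst d. det (matrix (jacobian c d p)) > 0))"

definition riemannian_manifold :: "('a, 'n::finite) rmfd \<Rightarrow> bool" where
  "riemannian_manifold M \<longleftrightarrow> smooth_manifold M \<and>
     (\<forall>c\<in>atlas_of M. \<forall>p\<in>fst c.
        bilinear (metric_of M c p) \<and>
        (\<forall>u v. metric_of M c p u v = metric_of M c p v u) \<and>
        (\<forall>u. u \<noteq> 0 \<longrightarrow> metric_of M c p u u > 0)) \<and>
     (\<forall>c\<in>atlas_of M. \<forall>u v. smooth_on (chart_image c) (\<lambda>x. metric_of M c (param c x) u v)) \<and>
     (\<forall>c\<in>atlas_of M. \<forall>d\<in>atlas_of M. \<forall>p\<in>fst c \<inter> fst d. \<forall>u v.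
        metric_of M d p (jacobian c d p u) (jacobian c d p v) = metric_of M c p u v)"

definition smooth_function :: "('a, 'n::finite) rmfd \<Rightarrow> ('a \<Rightarrow> real) \<Rightarrow> bool" where
  "smooth_function M \<phi> \<longleftrightarrow> (\<forall>c\<in>atlas_of M. smooth_on (chart_image c) (\<phi> \<circ> param c))"

text \<open>Smooth sections of the pull-back of the tangent bundle of \<open>N\<close> under \<open>f\<close>;
  \<open>V d p\<close> is the component vector, in the chart \<open>d\<close> of \<open>N\<close>, of the value at \<open>p\<close>.\<close>

definition vector_field_along ::
  "('a, 'n::finite) rmfd \<Rightarrow> ('b, 'k::finite) rmfd \<Rightarrow> ('a \<Rightarrow> 'b) \<Rightarrow> (('b, 'k) chart \<Rightarrow> 'a \<Rightarrow> real^'k) \<Rightarrow> bool" where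
  "vector_field_along M N f V \<longleftrightarrow>
     (\<forall>c\<in>atlas_of M. \<forall>d\<in>atlas_of N. smooth_on (snd c ` (fst c \<inter> f -` fst d)) (V d \<circ> param c)) \<and>
     (\<forall>d\<in>atlas_of N. \<forall>e\<in>atlas_of N. \<forall>p\<in>topspace (top_of M). f p \<in> fst d \<inter> fst e \<longrightarrow>
        jacobian d e (f p) (V d p) = V e p)"

definition vector_field :: "('a, 'n::finite) rmfd \<Rightarrow> (('a, 'n) chart \<Rightarrow> 'a \<Rightarrow> real^'n) \<Rightarrow> bool" where
  "vector_field M V \<longleftrightarrow> vector_field_along M M (\<lambda>p. p) V"

definition one_form :: "('a, 'n::finite) rmfd \<Rightarrow> (('a, 'n) chart \<Rightarrow> 'a \<Rightarrow> real^'n \<Rightarrow> real) \<Rightarrow> bool" where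
  "one_form M \<omega> \<longleftrightarrow>
     (\<forall>c\<in>atlas_of M. \<forall>p\<in>fst c. linear (\<omega> c p)) \<and>
     (\<forall>c\<in>atlas_of M. \<forall>u. smooth_on (chart_image c) (\<lambda>x. \<omega> c (param c x) u)) \<and>
     (\<forall>c\<in>atlas_of M. \<forall>d\<in>atlas_of M. \<forall>p\<in>fst c \<inter> fst d. \<forall>u. \<omega> d p (jacobian c d p u) = \<omega> c p u)"


section \<open>Musical isomorphism\<close>

definition sharp :: "('v \<Rightarrow> 'v \<Rightarrow> real) \<Rightarrow> ('v \<Rightarrow> real) \<Rightarrow> 'v" where
  "sharp g \<omega> = (THE w. \<forall>u. g w u = \<omega> u)"

definition covector_norm :: "('v \<Rightarrow> 'v \<Rightarrow> real) \<Rightarrow> ('v \<Rightarrow> real) \<Rightarrow> real" where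
  "covector_norm g \<omega> = sqrt (g (sharp g \<omega>) (sharp g \<omega>))"

definition dual_field ::
  "('a, 'n::finite) rmfd \<Rightarrow> (('a, 'n) chart \<Rightarrow> 'a \<Rightarrow> real^'n \<Rightarrow> real) \<Rightarrow> ('a, 'n) chart \<Rightarrow> 'a \<Rightarrow> real^'n" where
  "dual_field M \<omega> c p = sharp (metric_of M c p) (\<omega> c p)"


section \<open>Riemannian geometry in a coordinate domain\<close>

text \<open>In this section \<open>G\<close> is a field of inner products on an open subset of coordinate space
  and \<open>X\<close>, \<open>Y\<close>, \<open>Z\<close>, \<open>V\<close> are vector fields on it.\<close>

type_synonym 'n metric_field = "real^'n \<Rightarrow> real^'n \<Rightarrow> real^'n \<Rightarrow> real"
type_synonym 'n field = "real^'n \<Rightarrow> real^'n"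

definition local_metric :: "('a, 'n::finite) rmfd \<Rightarrow> ('a, 'n) chart \<Rightarrow> 'n metric_field" where
  "local_metric M c x = metric_of M c (param c x)"

definition lie_bracket :: "'n::finite field \<Rightarrow> 'n field \<Rightarrow> 'n field" where
  "lie_bracket X Y x = frechet_derivative Y (at x) (X x) - frechet_derivative X (at x) (Y x)"

text \<open>The Koszul formula for the constant fields \<open>u\<close>, \<open>v\<close>, \<open>w\<close>, whose Lie brackets vanish:
  \<open>christoffel G x u v\<close> is the value at \<open>x\<close> of the Levi-Civita derivative of \<open>v\<close> along \<open>u\<close>.\<close>

definition christoffel :: "'n::finite metric_field \<Rightarrow> real^'n \<Rightarrow> real^'n \<Rightarrow> real^'n \<Rightarrow> real^'n" where
  "christoffel G x u v = sharp (G x) (\<lambda>w.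
     (frechet_derivative (\<lambda>z. G z v w) (at x) u
      + frechet_derivative (\<lambda>z. G z u w) (at x) v
      - frechet_derivative (\<lambda>z. G z u v) (at x) w) / 2)"

definition levi_civita :: "'n::finite metric_field \<Rightarrow> 'n field \<Rightarrow> 'n field \<Rightarrow> 'n field" where
  "levi_civita G X Y x = frechet_derivative Y (at x) (X x) + christoffel G x (X x) (Y x)"

definition curvature :: "'n::finite metric_field \<Rightarrow> 'n field \<Rightarrow> 'n field \<Rightarrow> 'n field \<Rightarrow> 'n field" where
  "curvature G X Y Z x =
     levi_civita G X (levi_civita G Y Z) x - levi_civita G Y (levi_civita G X Z) x
     - levi_civita G (lie_bracket X Y) Z x"

text \<open>Since the curvature is tensorial, the tangent vector \<open>z\<close> at \<open>x\<close> may be extended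
  to the constant field \<open>\<lambda>_. z\<close>.\<close>

definition ricci :: "'n::finite metric_field \<Rightarrow> 'n field \<Rightarrow> 'n field \<Rightarrow> real^'n \<Rightarrow> real" where
  "ricci G X Y x = trace (matrix (\<lambda>z. curvature G (\<lambda>_. z) X Y x))"

definition lie_derivative :: "'n::finite field \<Rightarrow> 'n metric_field \<Rightarrow> 'n field \<Rightarrow> 'n field \<Rightarrow> real^'n \<Rightarrow> real" where
  "lie_derivative V G X Y x =
     frechet_derivative (\<lambda>z. G z (X z) (Y z)) (at x) (V x)
     - G x (lie_bracket V X x) (Y x) - G x (X x) (lie_bracket V Y x)"

definition ricci_soliton ::
  "('a, 'n::finite) rmfd \<Rightarrow> (('a, 'n) chart \<Rightarrow> 'a \<Rightarrow> real^'n) \<Rightarrow> real \<Rightarrow> bool" where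
  "ricci_soliton M V lam \<longleftrightarrow> vector_field M V \<and>
     (\<forall>c\<in>atlas_of M. \<forall>X Y. smooth_on (chart_image c) X \<and> smooth_on (chart_image c) Y \<longrightarrow>
        (\<forall>x\<in>chart_image c.
           lie_derivative (\<lambda>z. V c (param c z)) (local_metric M c) X Y x
           + 2 * ricci (local_metric M c) X Y x
           + 2 * lam * local_metric M c x (X x) (Y x) = 0))"


section \<open>Hypersurfaces\<close>

definition local_rep ::
  "('a, 'n) chart \<Rightarrow> ('b, 'k) chart \<Rightarrow> ('a \<Rightarrow> 'b) \<Rightarrow> real^'n \<Rightarrow> real^'k" where
  "local_rep c d f = snd d \<circ> f \<circ> param c"

definition differential ::
  "('a, 'n::finite) chart \<Rightarrow> ('b, 'k::finite) chart \<Rightarrow> ('a \<Rightarrow> 'b) \<Rightarrow> 'a \<Rightarrow> real^'n \<Rightarrow> real^'k" where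
  "differential c d f p = frechet_derivative (local_rep c d f) (at (snd c p))"

definition smooth_map :: "('a, 'n::finite) rmfd \<Rightarrow> ('b, 'k::finite) rmfd \<Rightarrow> ('a \<Rightarrow> 'b) \<Rightarrow> bool" where
  "smooth_map M N f \<longleftrightarrow> continuous_map (top_of M) (top_of N) f \<and>
     (\<forall>c\<in>atlas_of M. \<forall>d\<in>atlas_of N. smooth_on (snd c ` (fst c \<inter> f -` fst d)) (local_rep c d f))"

text \<open>The metric of \<open>M\<close> is the one induced by the immersion \<open>f\<close>.\<close>

definition hypersurface :: "('a, 'n::finite) rmfd \<Rightarrow> ('b, 'k::finite) rmfd \<Rightarrow> ('a \<Rightarrow> 'b) \<Rightarrow> bool" where
  "hypersurface M N f \<longleftrightarrow> CARD('k) = CARD('n) + 1 \<and>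
     riemannian_manifold M \<and> smooth_map M N f \<and>
     (\<forall>c\<in>atlas_of M. \<forall>d\<in>atlas_of N. \<forall>p\<in>fst c \<inter> f -` fst d.
        inj (differential c d f p) \<and>
        (\<forall>u v. metric_of M c p u v =
           metric_of N d (f p) (differential c d f p u) (differential c d f p v)))"

definition unit_normal_field ::
  "('a, 'n::finite) rmfd \<Rightarrow> ('b, 'k::finite) rmfd \<Rightarrow> ('a \<Rightarrow> 'b) \<Rightarrow> (('b, 'k) chart \<Rightarrow> 'a \<Rightarrow> real^'k) \<Rightarrow> bool" where
  "unit_normal_field M N f \<nu> \<longleftrightarrow> vector_field_along M N f \<nu> \<and>
     (\<forall>c\<in>atlas_of M. \<forall>d\<in>atlas_of N. \<forall>p\<in>fst c \<inter> f -` fst d.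
        metric_of N d (f p) (\<nu> d p) (\<nu> d p) = 1 \<and>
        (\<forall>u. metric_of N d (f p) (differential c d f p u) (\<nu> d p) = 0))"

text \<open>\<open>second_form N c d f \<nu> p u v\<close> is the inner product of \<open>\<nu>\<close> with the Levi-Civita derivative
  in \<open>N\<close>, along \<open>df(u)\<close>, of \<open>df(v)\<close>, where \<open>v\<close> is extended to a constant
  field in the chart \<open>c\<close>.\<close>

definition second_form ::
  "('b, 'k::finite) rmfd \<Rightarrow> ('a, 'n::finite) chart \<Rightarrow> ('b, 'k) chart \<Rightarrow> ('a \<Rightarrow> 'b) \<Rightarrow>
   (('b, 'k) chart \<Rightarrow> 'a \<Rightarrow> real^'k) \<Rightarrow> 'a \<Rightarrow> real^'n \<Rightarrow> real^'n \<Rightarrow> real" where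
  "second_form N c d f \<nu> p u v =
     metric_of N d (f p)
       (frechet_derivative (\<lambda>z. frechet_derivative (local_rep c d f) (at z) v) (at (snd c p)) u
        + christoffel (local_metric N d) (snd d (f p)) (differential c d f p u) (differential c d f p v))
       (\<nu> d p)"

definition second_fundamental_form ::
  "('a, 'n::finite) rmfd \<Rightarrow> ('b, 'k::finite) rmfd \<Rightarrow> ('a \<Rightarrow> 'b) \<Rightarrow> (('b, 'k) chart \<Rightarrow> 'a \<Rightarrow> real^'k) \<Rightarrow>
   (('a, 'n) chart \<Rightarrow> 'a \<Rightarrow> real^'n \<Rightarrow> real^'n \<Rightarrow> real) \<Rightarrow> bool" where
  "second_fundamental_form M N f \<nu> h \<longleftrightarrow>
     (\<forall>c\<in>atlas_of M. \<forall>d\<in>atlas_of N. \<forall>p\<in>fst c \<inter> f -` fst d. \<forall>u v.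
        h c p u v = second_form N c d f \<nu> p u v)"

definition quasi_umbilical ::
  "('a, 'n::finite) rmfd \<Rightarrow> ('b, 'k::finite) rmfd \<Rightarrow> ('a \<Rightarrow> 'b) \<Rightarrow> (('b, 'k) chart \<Rightarrow> 'a \<Rightarrow> real^'k) \<Rightarrow>
   ('a \<Rightarrow> real) \<Rightarrow> ('a \<Rightarrow> real) \<Rightarrow> (('a, 'n) chart \<Rightarrow> 'a \<Rightarrow> real^'n \<Rightarrow> real) \<Rightarrow> bool" where
  "quasi_umbilical M N f \<nu> \<alpha> \<beta> \<eta> \<longleftrightarrow>
     smooth_function M \<alpha> \<and> smooth_function M \<beta> \<and> one_form M \<eta> \<and>
     (\<forall>c\<in>atlas_of M. \<forall>p\<in>fst c. covector_norm (metric_of M c p) (\<eta> c p) = 1) \<and>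
     second_fundamental_form M N f \<nu>
       (\<lambda>c p u v. \<alpha> p * metric_of M c p u v + \<beta> p * (\<eta> c p u * \<eta> c p v))"


section \<open>Real projective space of constant sectional curvature \<open>c\<close>\<close>

text \<open>The sphere of radius \<open>1 / sqrt c\<close> modulo the antipodal map, with the quotient metric.
  If \<open>'k\<close> has \<open>m\<close> elements, the space \<open>(real^'k) \<times> real\<close> has dimension \<open>m + 1\<close> and the
  quotient has dimension \<open>m\<close>.\<close>

definition rp_points :: "real \<Rightarrow> ((real^'k::finite) \<times> real) set set" where
  "rp_points c = (\<lambda>x. {x, - x}) ` sphere 0 (1 / sqrt c)"

definition rp_topology :: "real \<Rightarrow> ((real^'k::finite) \<times> real) set topology" where
  "rp_topology c = topology (\<lambda>W. W \<subseteq> rp_points c \<and>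
     openin (top_of_set (sphere 0 (1 / sqrt c))) {x \<in> sphere 0 (1 / sqrt c). {x, - x} \<in> W})"

text \<open>The affine chart with respect to the linear coordinates \<open>A\<close>.\<close>

definition rp_chart ::
  "real \<Rightarrow> ((real^'k::finite) \<times> real \<Rightarrow> (real^'k) \<times> real) \<Rightarrow> (((real^'k) \<times> real) set, 'k) chart" where
  "rp_chart c A =
     ({P \<in> rp_points c. \<forall>x\<in>P. snd (A x) \<noteq> 0},
      \<lambda>P. (\<lambda>x. fst (A x) /\<^sub>R snd (A x)) (SOME x. x \<in> P))"

text \<open>The inverse of the affine chart \<open>rp_chart c A\<close> lifts to the map
  \<open>inv A \<circ> rp_lift c\<close> into the sphere. As only orthogonal \<open>A\<close> are used, the metric pulled
  back by this lift is the one pulled back by \<open>rp_lift c\<close>.\<close>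

definition rp_lift :: "real \<Rightarrow> real^'k::finite \<Rightarrow> (real^'k) \<times> real" where
  "rp_lift c y = (1 / (sqrt c * norm (y, 1::real))) *\<^sub>R (y, 1)"

definition rp_space :: "real \<Rightarrow> (((real^'k::finite) \<times> real) set, 'k) rmfd" where
  "rp_space c =
     \<lparr> top_of = rp_topology c,
       atlas_of = {rp_chart c A | A. orthogonal_transformation A},
       metric_of = (\<lambda>d P u v.
         frechet_derivative (rp_lift c) (at (snd d P)) u \<bullet>
         frechet_derivative (rp_lift c) (at (snd d P)) v) \<rparr>"


section \<open>Betti numbers\<close>

definition int_independent :: "('a, 'b) monoid_scheme \<Rightarrow> 'a set \<Rightarrow> bool" where
  "int_independent G S \<longleftrightarrow> finite S \<and> S \<subseteq> carrier G \<and>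
     (\<forall>m :: 'a \<Rightarrow> int. finprod G (\<lambda>x. x [^]\<^bsub>G\<^esub> m x) S = \<one>\<^bsub>G\<^esub> \<longrightarrow> (\<forall>x\<in>S. m x = 0))"

definition abelian_rank :: "('a, 'b) monoid_scheme \<Rightarrow> enat" where
  "abelian_rank G = (SUP S\<in>{S. int_independent G S}. enat (card S))"

text \<open>The rank of integral homology is the dimension of homology with real coefficients.\<close>

definition betti_number :: "nat \<Rightarrow> 'a topology \<Rightarrow> enat" where
  "betti_number p X = abelian_rank (homology_group (int p) X)"

definition real_homology_sphere :: "nat \<Rightarrow> 'a topology \<Rightarrow> bool" where
  "real_homology_sphere n X \<longleftrightarrow> (\<forall>p. betti_number p X = (if p = 0 \<or> p = n then 1 else 0))"

end

(* No compact M satisfies the hypotheses, so only the sign of lambda needs the soliton equation.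

   Sign of lambda: evaluate the soliton equation at (xi, xi). The Lie derivative term vanishes since
   xi has length one, and the Gauss equation gives S(xi, xi) = (n - 1) (c + alpha^2 + alpha beta) > 0.

   Non-compactness: lift M locally to an immersion F into the sphere of curvature c, with unit normal
   N; reversing N we may take alpha, beta > 0. By the Codazzi equation the form omega = beta eta is
   closed and d alpha = rho omega. The hyperspheres enveloped by M have the centre vectors
   E = N + alpha F, and dE = omega F1, dF1 = omega F2, d rho = omega sigma. Moreover
   1 / beta = F2 . F - sigma / c, so that on the leaves of ker eta the function 1 / beta is the
   restriction of an affine function. At a minimum of alpha + e / beta, e > 0, the second derivatives
   along a leaf give sigma <= - c / beta, and the second derivative across the leaves then gives
   c omega(u0)^2 / beta <= e W with W continuous and independent of e. This fails for small e near
   every point, hence on all of a compact M, on which alpha + e / beta would have a minimum. *)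

theory Submission
  imports Defs
begin

section \<open>Calculus of smooth maps\<close>

text \<open>Why a penalty: \<open>\<alpha>\<close> is constant on the leaves of ker eta, so a
  minimum of \<open>\<alpha>\<close> alone yields only rho = 0 and sigma >= 0. With the leaves at
  hand one would minimise 1 / beta over the set where \<open>\<alpha>\<close> is minimal. That set
  contains the leaf through each of its points, and 1 / beta, affine on the leaf, can have its
  minimum there only if sigma <= - (rho^2 / beta + alpha + (alpha^2 + c) / beta) < 0, a
  contradiction. The single function \<open>\<alpha> + e / \<beta>\<close> imitates this two-stage
  minimum by derivatives at one point, so the foliation never has to be integrated; the price is the
  term e W. The computation takes place in the ambient Euclidean space of dimension n + 2, where
  fields along F are differentiated componentwise and the Codazzi equation is the symmetry of the
  second derivatives of E.\<close>

abbreviation dd :: "('a::euclidean_space \<Rightarrow> 'b::real_normed_vector) \<Rightarrow> 'a \<Rightarrow> 'a \<Rightarrow> 'b" where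
  "dd f v \<equiv> (\<lambda>x. frechet_derivative f (at x) v)"

lemma dd_eqI: "(f has_derivative f') (at x) \<Longrightarrow> dd f v x = f' v"
  by (simp add: frechet_derivative_at[symmetric])

text \<open>Differentiability is not at issue: \<open>frechet_derivative\<close> is a choice among
  the derivatives at x, and f and g have the same ones.\<close>

lemma dd_cong:
  assumes "open S" "x \<in> S" "\<And>z. z \<in> S \<Longrightarrow> f z = g z"
  shows "frechet_derivative f (at x) = frechet_derivative g (at x)"
proof -
  have "(f has_derivative D) (at x) \<longleftrightarrow> (g has_derivative D) (at x)" for D
    using has_derivative_transform_within_open[OF _ assms(1,2)] assms(3) by metis
  then show ?thesis unfolding frechet_derivative_def by simp
qed

lemma differentiable_cong_open:
  assumes "open S" "x \<in> S" "\<And>z. z \<in> S \<Longrightarrow> f z = g z"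
  shows "f differentiable (at x) \<longleftrightarrow> g differentiable (at x)"
  using has_derivative_transform_within_open[OF _ assms(1,2)] assms(3)
  unfolding differentiable_def by metis

section \<open>Closure properties of finite differentiability\<close>

lemma Ck_on_cong:
  assumes "open S" "\<And>x. x \<in> S \<Longrightarrow> f x = g x"
  shows "Ck_on k S f \<longleftrightarrow> Ck_on k S g"
  using assms(2)
proof (induction k arbitrary: f g)
  case 0
  then show ?case by (simp cong: continuous_on_cong)
next
  case (Suc k)
  have "Ck_on k S (dd f v) \<longleftrightarrow> Ck_on k S (dd g v)" for v
    using Suc.IH[of "dd f v" "dd g v"] dd_cong[OF assms(1) _ Suc.prems] by simp
  then show ?case using differentiable_cong_open[OF assms(1) _ Suc.prems] by simp
qed

lemma Ck_on_subset: "Ck_on k S f \<Longrightarrow> T \<subseteq> S \<Longrightarrow> Ck_on k T f"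
  by (induction k arbitrary: f) (auto intro: continuous_on_subset)

lemma Ck_on_SucD: "Ck_on (Suc k) S f \<Longrightarrow> Ck_on k S f"
proof (induction k arbitrary: f)
  case 0
  then show ?case
    by (auto intro!: continuous_at_imp_continuous_on differentiable_imp_continuous_within)
next
  case (Suc k)
  then show ?case by (metis Ck_on.simps(2))
qed

lemma Ck_on_const: "Ck_on k S (\<lambda>x. a)"
  by (induction k arbitrary: a) auto

lemma Ck_on_bounded_linear:
  assumes "bounded_linear h" "open S"
  shows "Ck_on k S f \<Longrightarrow> Ck_on k S (\<lambda>x. h (f x))"
proof (induction k arbitrary: f)
  case 0
  then show ?case
    using bounded_linear.continuous_on[OF assms(1)] by simp
next
  case (Suc k)
  have *: "((\<lambda>x. h (f x)) has_derivative (\<lambda>v. h (dd f v x))) (at x)" if "x \<in> S" for x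
    by (rule bounded_linear.has_derivative[OF assms(1)])
      (use Suc.prems that in \<open>simp add: frechet_derivative_works\<close>)
  have "Ck_on k S (dd (\<lambda>x. h (f x)) v)" for v
    using Suc.IH[of "dd f v"] Suc.prems Ck_on_cong[OF assms(2), of "dd (\<lambda>x. h (f x)) v"]
    by (simp add: dd_eqI[OF *])
  then show ?case using * by (auto simp: differentiable_def)
qed

lemma Ck_on_add:
  assumes "open S"
  shows "Ck_on k S f \<Longrightarrow> Ck_on k S g \<Longrightarrow> Ck_on k S (\<lambda>x. f x + g x)"
proof (induction k arbitrary: f g)
  case 0
  then show ?case by (simp add: continuous_on_add)
next
  case (Suc k)
  have *: "((\<lambda>x. f x + g x) has_derivative (\<lambda>v. dd f v x + dd g v x)) (at x)" if "x \<in> S" for x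
    using Suc.prems that by (auto simp: frechet_derivative_works intro!: has_derivative_add)
  have "Ck_on k S (dd (\<lambda>x. f x + g x) v)" for v
    using Suc.IH[of "dd f v" "dd g v"] Suc.prems
      Ck_on_cong[OF assms, of "dd (\<lambda>x. f x + g x) v"]
    by (simp add: dd_eqI[OF *])
  then show ?case using * by (auto simp: differentiable_def)
qed

lemma Ck_on_bilinear:
  assumes "bounded_bilinear h" "open S"
  shows "Ck_on k S f \<Longrightarrow> Ck_on k S g \<Longrightarrow> Ck_on k S (\<lambda>x. h (f x) (g x))"
proof (induction k arbitrary: f g)
  case 0
  then show ?case using bounded_bilinear.continuous_on[OF assms(1)] by simp
next
  case (Suc k)
  have *: "((\<lambda>x. h (f x) (g x)) has_derivative (\<lambda>v. h (f x) (dd g v x) + h (dd f v x) (g x))) (at x)"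
    if "x \<in> S" for x
    by (rule bounded_bilinear.FDERIV[OF assms(1)])
      (use Suc.prems that in \<open>simp_all add: frechet_derivative_works\<close>)
  have "Ck_on k S (\<lambda>x. h (f x) (dd g v x) + h (dd f v x) (g x))" for v
    using Suc by (intro Ck_on_add[OF assms(2)] Suc.IH) (auto intro!: Ck_on_SucD[OF Suc.prems(1)] Ck_on_SucD[OF Suc.prems(2)])
  then have "Ck_on k S (dd (\<lambda>x. h (f x) (g x)) v)" for v
    using Ck_on_cong[OF assms(2), of "dd (\<lambda>x. h (f x) (g x)) v"]
    by (simp add: dd_eqI[OF *])
  then show ?case using * by (auto simp: differentiable_def)
qed

lemma Ck_on_sum:
  assumes "open S"
  shows "finite I \<Longrightarrow> (\<And>i. i \<in> I \<Longrightarrow> Ck_on k S (f i)) \<Longrightarrow> Ck_on k S (\<lambda>x. \<Sum>i\<in>I. f i x)"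
  by (induction I rule: finite_induct) (auto simp: Ck_on_const intro!: Ck_on_add[OF assms])

lemma linear_sum_Basis:
  assumes "linear h"
  shows "h (v::'a::euclidean_space) = (\<Sum>i\<in>Basis. (v \<bullet> i) *\<^sub>R h i)"
proof -
  have "h v = h (\<Sum>i\<in>Basis. (v \<bullet> i) *\<^sub>R i)" by (simp add: euclidean_representation)
  also have "\<dots> = (\<Sum>i\<in>Basis. (v \<bullet> i) *\<^sub>R h i)"
    by (simp add: linear_sum[OF assms] linear_cmul[OF assms])
  finally show ?thesis .
qed

text \<open>The chain rule produces \<open>dd g\<close> in a direction that moves with x, whereas
  \<open>Ck_on\<close> speaks of fixed directions. Expanding the direction in the basis reduces to
  these.\<close>

lemma Ck_on_compose:
  fixes f :: "'a::euclidean_space \<Rightarrow> 'b::euclidean_space" and g :: "'b \<Rightarrow> 'c::real_normed_vector"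
  assumes "open S"
  shows "Ck_on k S f \<Longrightarrow> Ck_on k T g \<Longrightarrow> f ` S \<subseteq> T \<Longrightarrow> Ck_on k S (\<lambda>x. g (f x))"
proof (induction k arbitrary: f g)
  case 0
  then show ?case using continuous_on_compose2 by auto
next
  case (Suc k)
  have *: "((\<lambda>x. g (f x)) has_derivative (\<lambda>v. dd g (dd f v x) (f x))) (at x)"
    if "x \<in> S" for x
  proof -
    have "f x \<in> T" using Suc.prems(3) that by auto
    then have "(g has_derivative frechet_derivative g (at (f x))) (at (f x))"
      using Suc.prems by (simp add: frechet_derivative_works)
    moreover have "(f has_derivative frechet_derivative f (at x)) (at x)"
      using Suc.prems that by (simp add: frechet_derivative_works)
    ultimately show ?thesis using has_derivative_compose by blast
  qed
  have "dd (\<lambda>x. g (f x)) v x = (\<Sum>i\<in>Basis. (dd f v x \<bullet> i) *\<^sub>R dd g i (f x))" if "x \<in> S" for v x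
    unfolding dd_eqI[OF *[OF that]]
    by (rule linear_sum_Basis[OF linear_frechet_derivative]) (use Suc.prems that in auto)
  moreover have "Ck_on k S (\<lambda>x. \<Sum>i\<in>Basis. (dd f v x \<bullet> i) *\<^sub>R dd g i (f x))" for v
    using Suc.prems
    by (intro Ck_on_sum[OF assms] Ck_on_bilinear[OF bounded_bilinear_scaleR assms]
        Ck_on_bounded_linear[OF bounded_linear_inner_left assms] Suc.IH)
      (auto intro: Ck_on_SucD)
  ultimately have "Ck_on k S (dd (\<lambda>x. g (f x)) v)" for v
    using Ck_on_cong[OF assms, of "dd (\<lambda>x. g (f x)) v"] by simp
  then show ?case using * by (auto simp: differentiable_def)
qed

section \<open>Closure properties of smooth maps\<close>

lemma smooth_on_cong:
  "open S \<Longrightarrow> (\<And>x. x \<in> S \<Longrightarrow> f x = g x) \<Longrightarrow> smooth_on S f \<longleftrightarrow> smooth_on S g"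
  unfolding smooth_on_def using Ck_on_cong by metis

lemma smooth_on_subset: "smooth_on S f \<Longrightarrow> T \<subseteq> S \<Longrightarrow> smooth_on T f"
  unfolding smooth_on_def using Ck_on_subset by metis

lemma smooth_on_const: "smooth_on S (\<lambda>x. a)"
  by (simp add: smooth_on_def Ck_on_const)

lemma smooth_on_dd: "smooth_on S f \<Longrightarrow> smooth_on S (dd f v)"
  unfolding smooth_on_def using Ck_on.simps(2) by blast

lemma smooth_on_differentiable: "smooth_on S f \<Longrightarrow> x \<in> S \<Longrightarrow> f differentiable (at x)"
  unfolding smooth_on_def using Ck_on.simps(2) by blast

lemma smooth_on_has_derivative:
  "smooth_on S f \<Longrightarrow> x \<in> S \<Longrightarrow> (f has_derivative (\<lambda>v. dd f v x)) (at x)"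
  using smooth_on_differentiable frechet_derivative_works by metis

lemma smooth_on_continuous: "smooth_on S f \<Longrightarrow> continuous_on S f"
  unfolding smooth_on_def using Ck_on.simps(1) by blast

lemma linear_dd_smooth: "smooth_on S f \<Longrightarrow> x \<in> S \<Longrightarrow> linear (\<lambda>v. dd f v x)"
  by (simp add: linear_frechet_derivative smooth_on_differentiable)

lemma smooth_on_bounded_linear:
  "bounded_linear h \<Longrightarrow> open S \<Longrightarrow> smooth_on S f \<Longrightarrow> smooth_on S (\<lambda>x. h (f x))"
  unfolding smooth_on_def using Ck_on_bounded_linear by blast

lemma smooth_on_id: "smooth_on S (\<lambda>x. x)"
proof -
  have "Ck_on k S (\<lambda>x. x)" for k
    by (cases k) (auto simp: Ck_on_const)
  then show ?thesis by (simp add: smooth_on_def)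
qed

lemma smooth_on_add:
  "open S \<Longrightarrow> smooth_on S f \<Longrightarrow> smooth_on S g \<Longrightarrow> smooth_on S (\<lambda>x. f x + g x)"
  unfolding smooth_on_def using Ck_on_add by blast

lemma smooth_on_uminus: "open S \<Longrightarrow> smooth_on S f \<Longrightarrow> smooth_on S (\<lambda>x. - f x)"
  by (rule smooth_on_bounded_linear[OF bounded_linear_minus[OF bounded_linear_ident]])

lemma smooth_on_diff:
  "open S \<Longrightarrow> smooth_on S f \<Longrightarrow> smooth_on S g \<Longrightarrow> smooth_on S (\<lambda>x. f x - g x)"
  using smooth_on_add[of S f "\<lambda>x. - g x"] smooth_on_uminus by auto

lemma smooth_on_bilinear:
  "bounded_bilinear h \<Longrightarrow> open S \<Longrightarrow> smooth_on S f \<Longrightarrow> smooth_on S g \<Longrightarrow>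
    smooth_on S (\<lambda>x. h (f x) (g x))"
  unfolding smooth_on_def using Ck_on_bilinear by blast

lemmas smooth_on_scaleR = smooth_on_bilinear[OF bounded_bilinear_scaleR]
  and smooth_on_inner = smooth_on_bilinear[OF bounded_bilinear_inner]

lemma smooth_on_mult:
  fixes f g :: "'a::euclidean_space \<Rightarrow> real"
  shows "open S \<Longrightarrow> smooth_on S f \<Longrightarrow> smooth_on S g \<Longrightarrow> smooth_on S (\<lambda>x. f x * g x)"
  by (rule smooth_on_bilinear[OF bounded_bilinear_mult])

lemma smooth_on_sum:
  "open S \<Longrightarrow> finite I \<Longrightarrow> (\<And>i. i \<in> I \<Longrightarrow> smooth_on S (f i)) \<Longrightarrow> smooth_on S (\<lambda>x. \<Sum>i\<in>I. f i x)"
  unfolding smooth_on_def using Ck_on_sum by blast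

lemma smooth_on_compose:
  fixes f :: "'a::euclidean_space \<Rightarrow> 'b::euclidean_space" and g :: "'b \<Rightarrow> 'c::real_normed_vector"
  shows "open S \<Longrightarrow> smooth_on S f \<Longrightarrow> smooth_on T g \<Longrightarrow> f ` S \<subseteq> T \<Longrightarrow> smooth_on S (\<lambda>x. g (f x))"
  unfolding smooth_on_def using Ck_on_compose by metis

lemma dd_compose:
  assumes "smooth_on S f" "smooth_on T g" "x \<in> S" "f x \<in> T"
  shows "dd (\<lambda>x. g (f x)) v x = dd g (dd f v x) (f x)"
  using has_derivative_compose[OF smooth_on_has_derivative smooth_on_has_derivative, OF assms(1,3,2,4)]
  by (rule dd_eqI)

text \<open>The derivative of a power is a multiple of another power, so the induction runs over all
  exponents at once.\<close>

lemma smooth_on_powr: "smooth_on {0<..} (\<lambda>t::real. t powr a)"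
proof -
  have "Ck_on k {0<..} (\<lambda>t::real. t powr a)" for k
  proof (induction k arbitrary: a)
    case 0
    then show ?case by (auto intro!: continuous_intros)
  next
    case (Suc k)
    have *: "((\<lambda>t. t powr a) has_derivative (\<lambda>v. (a * v) * t powr (a - 1))) (at t)" if "t > 0" for t :: real
      using has_real_derivative_powr[OF that, of a]
      by (auto simp: has_field_derivative_def mult_ac elim!: has_derivative_eq_rhs)
    have "Ck_on k {0<..} (\<lambda>t::real. (a * v) *\<^sub>R t powr (a - 1))" for v
      by (rule Ck_on_bounded_linear[OF bounded_linear_scaleR_right open_greaterThan Suc.IH])
    then have "Ck_on k {0<..} (dd (\<lambda>t::real. t powr a) v)" for v
      using Ck_on_cong[of "{0<..}" "dd (\<lambda>t::real. t powr a) v"] by (simp add: dd_eqI[OF *])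
    then show ?case using * by (auto simp: differentiable_def)
  qed
  then show ?thesis by (simp add: smooth_on_def)
qed

lemma smooth_on_inverse:
  fixes f :: "'a::euclidean_space \<Rightarrow> real"
  assumes "open S" "smooth_on S f" "\<And>x. x \<in> S \<Longrightarrow> f x > 0"
  shows "smooth_on S (\<lambda>x. inverse (f x))"
proof -
  have "smooth_on S (\<lambda>x. f x powr -1)"
    by (rule smooth_on_compose[OF assms(1,2) smooth_on_powr]) (use assms(3) in auto)
  then show ?thesis
    using smooth_on_cong[OF assms(1), of "\<lambda>x. f x powr -1" "\<lambda>x. inverse (f x)"] assms(3)
    by (simp add: powr_minus less_imp_le)
qed

section \<open>Differentiation rules\<close>

lemma dd_add:
  "smooth_on S f \<Longrightarrow> smooth_on S g \<Longrightarrow> x \<in> S \<Longrightarrow> dd (\<lambda>x. f x + g x) v x = dd f v x + dd g v x"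
  by (rule dd_eqI[OF has_derivative_add[OF smooth_on_has_derivative smooth_on_has_derivative]])

lemma dd_diff:
  "smooth_on S f \<Longrightarrow> smooth_on S g \<Longrightarrow> x \<in> S \<Longrightarrow> dd (\<lambda>x. f x - g x) v x = dd f v x - dd g v x"
  by (rule dd_eqI[OF has_derivative_diff[OF smooth_on_has_derivative smooth_on_has_derivative]])

lemma dd_uminus: "smooth_on S f \<Longrightarrow> x \<in> S \<Longrightarrow> dd (\<lambda>x. - f x) v x = - dd f v x"
  by (rule dd_eqI[OF has_derivative_minus[OF smooth_on_has_derivative]])

lemma dd_bilinear:
  "bounded_bilinear h \<Longrightarrow> smooth_on S f \<Longrightarrow> smooth_on S g \<Longrightarrow> x \<in> S \<Longrightarrow>
    dd (\<lambda>x. h (f x) (g x)) v x = h (f x) (dd g v x) + h (dd f v x) (g x)"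
  by (rule dd_eqI[OF bounded_bilinear.FDERIV[OF _ smooth_on_has_derivative smooth_on_has_derivative]])

lemmas dd_scaleR = dd_bilinear[OF bounded_bilinear_scaleR]
  and dd_inner = dd_bilinear[OF bounded_bilinear_inner]

lemma dd_mult:
  fixes f g :: "'a::euclidean_space \<Rightarrow> real"
  shows "smooth_on S f \<Longrightarrow> smooth_on S g \<Longrightarrow> x \<in> S \<Longrightarrow>
    dd (\<lambda>x. f x * g x) v x = f x * dd g v x + dd f v x * g x"
  by (rule dd_bilinear[OF bounded_bilinear_mult])

section \<open>Symmetry of second derivatives\<close>

lemma dd_line:
  assumes "smooth_on S f" "x + s *\<^sub>R v \<in> S"
  shows "((\<lambda>s. f (x + s *\<^sub>R v)) has_vector_derivative dd f v (x + s *\<^sub>R v)) (at s)"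
proof -
  have "((\<lambda>s. f (x + s *\<^sub>R v)) has_derivative (\<lambda>h. dd f (h *\<^sub>R v) (x + s *\<^sub>R v))) (at s)"
    by (rule has_derivative_compose[where f = "\<lambda>s. x + s *\<^sub>R v" and g = f, OF _ smooth_on_has_derivative[OF assms]])
      (auto intro!: derivative_eq_intros)
  moreover have "dd f (h *\<^sub>R v) (x + s *\<^sub>R v) = h *\<^sub>R dd f v (x + s *\<^sub>R v)" for h
    using linear_cmul[OF linear_dd_smooth[OF assms]] .
  ultimately show ?thesis by (simp add: has_vector_derivative_def)
qed

text \<open>The second difference of f over a small parallelogram is symmetric in u and v. Two
  applications of the mean value theorem, in either order, turn it into either mixed derivative at a
  nearby point; continuity does the rest.\<close>

lemma dd_symmetric_real:
  fixes f :: "'a::euclidean_space \<Rightarrow> real"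
  assumes "open S" "smooth_on S f" "x \<in> S"
  shows "dd (dd f u) v x = dd (dd f v) u x"
proof -
  have mvt: "\<exists>y. dist y x \<le> h * (norm u + norm v) \<and>
      f (x + h *\<^sub>R u + h *\<^sub>R v) - f (x + h *\<^sub>R u) - f (x + h *\<^sub>R v) + f x = h * (h * dd (dd f u) v y)"
    if h: "h > 0" and S: "\<And>y. dist y x \<le> h * (norm u + norm v) \<Longrightarrow> y \<in> S" for h u v
  proof -
    have near: "dist (x + s *\<^sub>R u + t *\<^sub>R v) x \<le> h * (norm u + norm v)" if "0 \<le> s" "s \<le> h" "0 \<le> t" "t \<le> h" for s t
    proof -
      have "norm (s *\<^sub>R u + t *\<^sub>R v) \<le> s * norm u + t * norm v"
        using norm_triangle_ineq[of "s *\<^sub>R u" "t *\<^sub>R v"] that by simp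
      also have "\<dots> \<le> h * norm u + h * norm v"
        using that by (intro add_mono mult_right_mono) auto
      finally show ?thesis by (simp add: dist_norm add.assoc ring_distribs)
    qed
    note inS = S[OF near]
    define g where "g s = f ((x + h *\<^sub>R v) + s *\<^sub>R u) - f (x + s *\<^sub>R u)" for s
    have g': "(g has_real_derivative dd f u ((x + h *\<^sub>R v) + s *\<^sub>R u) - dd f u (x + s *\<^sub>R u)) (at s)"
      if "0 \<le> s" "s \<le> h" for s
      unfolding g_def has_real_derivative_iff_has_vector_derivative
      using inS[of s h] inS[of s 0] that h
      by (intro has_vector_derivative_diff dd_line[OF assms(2)]) (auto simp: add_ac)
    obtain s where s: "0 < s" "s < h"
      "g h - g 0 = h * (dd f u ((x + h *\<^sub>R v) + s *\<^sub>R u) - dd f u (x + s *\<^sub>R u))"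
      using MVT2[OF h, of g, OF g'] by auto
    define k where "k t = dd f u ((x + s *\<^sub>R u) + t *\<^sub>R v)" for t
    have k': "(k has_real_derivative dd (dd f u) v ((x + s *\<^sub>R u) + t *\<^sub>R v)) (at t)"
      if "0 \<le> t" "t \<le> h" for t
      unfolding k_def has_real_derivative_iff_has_vector_derivative
      using inS[of s t] s that
      by (intro dd_line[OF smooth_on_dd[OF assms(2)]]) auto
    obtain t where t: "0 < t" "t < h" "k h - k 0 = h * dd (dd f u) v ((x + s *\<^sub>R u) + t *\<^sub>R v)"
      using MVT2[OF h, of k, OF k'] by auto
    have "g h - g 0 = h * (h * dd (dd f u) v ((x + s *\<^sub>R u) + t *\<^sub>R v))"
      using s(3) t(3) by (simp add: k_def add_ac)
    then show ?thesis using near[of s t] s t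
      by (intro exI[of _ "x + s *\<^sub>R u + t *\<^sub>R v"]) (auto simp: g_def add_ac)
  qed
  show ?thesis
  proof (rule ccontr)
    define a where "a = dd (dd f u) v" define b where "b = dd (dd f v) u"
    assume "\<not> ?thesis"
    then have ne: "dist (a x) (b x) > 0" by (simp add: a_def b_def)
    have "continuous_on S a" "continuous_on S b"
      by (auto simp: a_def b_def intro!: smooth_on_continuous smooth_on_dd assms)
    then have "isCont a x" "isCont b x" using assms(1,3) continuous_on_eq_continuous_at by blast+
    then obtain d1 d2 where d: "d1 > 0" "\<And>y. dist y x < d1 \<Longrightarrow> dist (a y) (a x) < dist (a x) (b x) / 2"
      "d2 > 0" "\<And>y. dist y x < d2 \<Longrightarrow> dist (b y) (b x) < dist (a x) (b x) / 2"
      using ne unfolding continuous_at_eps_delta by (metis half_gt_zero dist_commute)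
    obtain d3 where d3: "d3 > 0" "\<And>y. dist y x < d3 \<Longrightarrow> y \<in> S"
      using assms(1,3) by (meson open_dist)
    define r where "r = min d1 (min d2 d3)"
    have r: "r > 0" using d d3 by (simp add: r_def)
    \<comment> \<open>The parallelogram with sides h u and h v then stays within r / 2 of x; the
      summand 1 keeps the denominator positive when u = v = 0.\<close>
    define h where "h = r / (2 * (norm u + norm v + 1))"
    have nn: "norm u + norm v + 1 > 0" by (smt (verit) norm_ge_zero)
    have h: "h > 0" using r nn by (simp add: h_def)
    have "h * (norm u + norm v) \<le> h * (norm u + norm v + 1)" using h by simp
    also have "\<dots> = r / 2" using nn by (simp add: h_def field_simps)
    finally have hr: "h * (norm u + norm v) < r" using r by simp
    have inS: "y \<in> S" if "dist y x \<le> h * (norm u + norm v)" for y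
      using that hr d3(2)[of y] by (simp add: r_def)
    have inS': "y \<in> S" if "dist y x \<le> h * (norm v + norm u)" for y
      using inS that by (simp add: add.commute)
    obtain y1 where y1: "dist y1 x \<le> h * (norm u + norm v)"
      "f (x + h *\<^sub>R u + h *\<^sub>R v) - f (x + h *\<^sub>R u) - f (x + h *\<^sub>R v) + f x = h * (h * a y1)"
      using mvt[OF h inS] by (auto simp: a_def)
    obtain y2 where y2: "dist y2 x \<le> h * (norm v + norm u)"
      "f (x + h *\<^sub>R v + h *\<^sub>R u) - f (x + h *\<^sub>R v) - f (x + h *\<^sub>R u) + f x = h * (h * b y2)"
      using mvt[OF h inS'] by (auto simp: b_def)
    have swap: "x + h *\<^sub>R v + h *\<^sub>R u = x + h *\<^sub>R u + h *\<^sub>R v" by simp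
    have "h * (h * a y1) = h * (h * b y2)" using y1(2) y2(2)[unfolded swap] by linarith
    then have "a y1 = b y2" using h by simp
    moreover have "dist (a y1) (a x) < dist (a x) (b x) / 2" "dist (b y2) (b x) < dist (a x) (b x) / 2"
      using d y1(1) y2(1) hr by (auto simp: r_def add.commute)
    ultimately show False by (smt (verit) dist_triangle dist_commute field_sum_of_halves)
  qed
qed

lemma dd_symmetric:
  fixes f :: "'a::euclidean_space \<Rightarrow> 'b::euclidean_space"
  assumes "open S" "smooth_on S f" "x \<in> S"
  shows "dd (dd f u) v x = dd (dd f v) u x"
proof (rule euclidean_eqI)
  fix b :: 'b
  have i: "dd (\<lambda>z. h z \<bullet> b) v z = dd h v z \<bullet> b" if "smooth_on S h" "z \<in> S" for h :: "'a \<Rightarrow> 'b" and v z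
    using dd_inner[OF that(1) smooth_on_const that(2), of b v] by simp
  have ii: "dd (dd (\<lambda>z. f z \<bullet> b) u) v x = dd (dd f u) v x \<bullet> b" for u v
    using dd_cong[OF assms(1,3), of "dd (\<lambda>z. f z \<bullet> b) u" "\<lambda>z. dd f u z \<bullet> b"] i[OF assms(2)]
      i[OF smooth_on_dd[OF assms(2)] assms(3)] by simp
  show "dd (dd f u) v x \<bullet> b = dd (dd f v) u x \<bullet> b"
    using dd_symmetric_real[OF assms(1) _ assms(3), of "\<lambda>z. f z \<bullet> b" u v] ii
      smooth_on_inner[OF assms(1,2) smooth_on_const] by simp
qed

section \<open>Quasi-umbilical immersions into a sphere\<close>

lemmas inner_expand = inner_add_left inner_add_right inner_diff_left inner_diff_right

text \<open>\<open>adjoint p 1\<close> is the vector representing p, so v has to be orthogonal to a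
  subspace of dimension at most 2.\<close>

lemma common_kernel_vector:
  fixes p q :: "'a::euclidean_space \<Rightarrow> real"
  assumes "linear p" "linear q" "DIM('a) > 2"
  obtains v where "v \<noteq> 0" "p v = 0" "q v = 0"
proof -
  have "dim {adjoint p 1, adjoint q 1} < DIM('a)"
    using dim_le_card[of "{adjoint p 1, adjoint q 1}" "{adjoint p 1, adjoint q 1}"] assms(3)
      card_insert_le_m1[of 2 "{adjoint q 1}" "adjoint p 1"] by (auto simp: span_superset)
  then obtain v where "v \<noteq> 0" "\<And>y. y \<in> span {adjoint p 1, adjoint q 1} \<Longrightarrow> orthogonal v y"
    using orthogonal_to_subspace_exists by blast
  then have "v \<bullet> adjoint p 1 = 0" "v \<bullet> adjoint q 1 = 0"
    by (auto simp: orthogonal_def span_base)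
  then show thesis
    using that[OF \<open>v \<noteq> 0\<close>] adjoint_works[OF assms(1), of v 1] adjoint_works[OF assms(2), of v 1] by simp
qed

text \<open>For the second claim: if the second derivative were negative, the derivative along the
  line, which is 0 at x, would be negative just after x, and f would fall below its minimum.\<close>

lemma minimum_second_order:
  fixes f :: "'a::euclidean_space \<Rightarrow> real"
  assumes "open S" "smooth_on S f" "x \<in> S" "\<And>y. y \<in> S \<Longrightarrow> f x \<le> f y"
  shows "dd f v x = 0" "dd (dd f v) v x \<ge> 0"
proof -
  show z: "dd f v x = 0" for v
    using differential_zero_maxmin[OF assms(3,1) smooth_on_has_derivative[OF assms(2,3)]] assms(4)
    by metis
  show "dd (dd f v) v x \<ge> 0"
  proof (rule ccontr)
    define g where "g s = f (x + s *\<^sub>R v)" for s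
    define g' where "g' s = dd f v (x + s *\<^sub>R v)" for s
    obtain e where e: "e > 0" "\<And>s. \<bar>s\<bar> < e \<Longrightarrow> x + s *\<^sub>R v \<in> S"
    proof -
      have "open ((\<lambda>s. x + s *\<^sub>R v) -` S)"
        by (rule open_vimage[OF assms(1)]) (intro continuous_intros)
      then obtain e where "e > 0" "ball 0 e \<subseteq> (\<lambda>s. x + s *\<^sub>R v) -` S"
        using assms(3) by (metis (no_types, lifting) open_contains_ball_eq add.right_neutral scaleR_zero_left vimageI)
      then show thesis by (intro that[of e]) (auto simp: subset_iff)
    qed
    assume "\<not> ?thesis"
    then have neg: "dd (dd f v) v x < 0" by simp
    have "DERIV g' 0 :> dd (dd f v) v x"
      using dd_line[OF smooth_on_dd[OF assms(2)], of x 0 v v] assms(3)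
      by (simp add: g'_def[abs_def] has_real_derivative_iff_has_vector_derivative)
    from DERIV_neg_dec_right[OF this neg] obtain d
      where d: "d > 0" "\<And>h. 0 < h \<Longrightarrow> h < d \<Longrightarrow> g' h < 0"
      using z by (auto simp: g'_def)
    define r where "r = min d e / 2"
    have r: "r > 0" "r < d" "r < e" using d(1) e(1) by (auto simp: r_def)
    have "DERIV g s :> g' s" if "0 \<le> s" "s \<le> r" for s
      using dd_line[OF assms(2) e(2), of s] that r
      by (simp add: g_def[abs_def] g'_def has_real_derivative_iff_has_vector_derivative)
    from MVT2[OF r(1), of g g', OF this] obtain s where "0 < s" "s < r" "g r - g 0 = (r - 0) * g' s"
      by auto
    then have "g r < g 0" using d(2)[of s] r by (smt (verit) mult_pos_neg)
    moreover have "g 0 \<le> g r" using assms(4) e(2)[of r] r by (simp add: g_def)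
    ultimately show False by simp
  qed
qed

text \<open>\<open>N\<close> is the unit normal in the sphere of curvature \<open>c\<close>, so \<open>dd (dd F v) u x \<bullet> N x\<close> is the second
  fundamental form of \<open>F\<close> as a hypersurface of that sphere.\<close>

locale spherical_patch =
  fixes U :: "'a::euclidean_space set" and F N :: "'a \<Rightarrow> 'b::euclidean_space" and c :: real
  assumes open_U: "open U" and smooth_F: "smooth_on U F" and smooth_N: "smooth_on U N"
    and c_pos: "c > 0" and codim: "DIM('b) = DIM('a) + 2"
    and F_F: "x \<in> U \<Longrightarrow> F x \<bullet> F x = 1 / c"
    and N_N: "x \<in> U \<Longrightarrow> N x \<bullet> N x = 1"
    and N_F: "x \<in> U \<Longrightarrow> N x \<bullet> F x = 0"
    and N_dF: "x \<in> U \<Longrightarrow> N x \<bullet> dd F u x = 0"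
    and dF_inj: "x \<in> U \<Longrightarrow> dd F u x = 0 \<Longrightarrow> u = 0"
begin

lemma inner_deriv_eq:
  assumes "smooth_on U A" "smooth_on U B" "\<And>z. z \<in> U \<Longrightarrow> A z \<bullet> B z = k z" "x \<in> U"
  shows "A x \<bullet> dd B u x + dd A u x \<bullet> B x = dd k u x"
  using dd_inner[OF assms(1,2,4), of u] dd_cong[OF open_U assms(4), of "\<lambda>z. A z \<bullet> B z" k] assms(3)
  by simp

lemma F_dF: "x \<in> U \<Longrightarrow> F x \<bullet> dd F u x = 0"
  using inner_deriv_eq[OF smooth_F smooth_F, of "\<lambda>_. 1 / c" x u] F_F by (simp add: inner_commute)

lemma ddF_F: "x \<in> U \<Longrightarrow> dd (dd F v) u x \<bullet> F x = - (dd F u x \<bullet> dd F v x)"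
  using inner_deriv_eq[OF smooth_F smooth_on_dd[OF smooth_F], of v "\<lambda>_. 0" x u] F_dF
  by (simp add: inner_commute)

lemma dN_N: "x \<in> U \<Longrightarrow> dd N u x \<bullet> N x = 0"
  using inner_deriv_eq[OF smooth_N smooth_N, of "\<lambda>_. 1" x u] N_N by (simp add: inner_commute)

lemma dN_F: "x \<in> U \<Longrightarrow> dd N u x \<bullet> F x = 0"
  using inner_deriv_eq[OF smooth_N smooth_F, of "\<lambda>_. 0" x u] N_F N_dF by simp

lemma dN_dF: "x \<in> U \<Longrightarrow> dd N u x \<bullet> dd F v x = - (dd (dd F v) u x \<bullet> N x)"
  using inner_deriv_eq[OF smooth_N smooth_on_dd[OF smooth_F], of v "\<lambda>_. 0" x u] N_dF
  by (simp add: inner_commute)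

text \<open>The tangent space, N and F are linearly independent, so by \<open>codim\<close> they
  span the ambient space. Later identities between ambient vectors are checked against this
  frame.\<close>

lemma eq_0_if_orthogonal:
  assumes x: "x \<in> U" and w: "w \<bullet> F x = 0" "w \<bullet> N x = 0" "\<And>u. w \<bullet> dd F u x = 0"
  shows "w = 0"
proof -
  define T where "T = (\<lambda>p::'a \<times> real \<times> real. dd F (fst p) x + fst (snd p) *\<^sub>R N x + snd (snd p) *\<^sub>R F x)"
  note lin = linear_dd_smooth[OF smooth_F x]
  have T: "linear T"
    unfolding T_def
    by (intro linearI) (auto simp: linear_add[OF lin] linear_cmul[OF lin] algebra_simps)
  have "inj T"
  proof (unfold linear_injective_0[OF T], intro allI impI)
    fix p assume p: "T p = 0"
    have "T p \<bullet> N x = fst (snd p)" "T p \<bullet> F x = snd (snd p) / c"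
      using N_N[OF x] N_F[OF x] N_dF[OF x] F_dF[OF x] F_F[OF x]
      by (auto simp: T_def inner_expand inner_commute)
    then have "fst (snd p) = 0" "snd (snd p) = 0" using p c_pos by auto
    moreover from this have "fst p = 0" using p dF_inj[OF x] by (simp add: T_def)
    ultimately show "p = 0" by (simp add: prod_eq_iff)
  qed
  then have "dim (range T) = DIM('b)"
    using dim_image_eq[OF T, of UNIV] codim by simp
  then have "range T = UNIV"
    using dim_eq_full[of "range T"] linear_subspace_image[OF T subspace_UNIV] span_eq_iff by metis
  then obtain p where "w = T p" by (metis UNIV_I imageE)
  then have "w \<bullet> w = w \<bullet> T p" by simp
  also have "\<dots> = 0" using w by (simp add: T_def inner_add_right)
  finally show ?thesis by simp
qed

end

text \<open>\<open>\<xi>\<close> is specified only pointwise, through \<open>dF_\<xi>\<close>; its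
  smoothness, where it matters, is derived.\<close>

locale quasi_umbilical_patch = spherical_patch U F N c
  for U :: "'a::euclidean_space set" and F N :: "'a \<Rightarrow> 'b::euclidean_space" and c :: real +
  fixes \<alpha> \<beta> :: "'a \<Rightarrow> real" and \<eta> :: "'a \<Rightarrow> 'a \<Rightarrow> real" and \<xi> :: "'a \<Rightarrow> 'a"
  assumes dim_gt_2: "DIM('a) > 2"
    and smooth_\<alpha>: "smooth_on U \<alpha>" and smooth_\<beta>: "smooth_on U \<beta>"
    and smooth_\<eta>: "smooth_on U (\<lambda>x. \<eta> x u)" and linear_\<eta>: "x \<in> U \<Longrightarrow> linear (\<eta> x)"
    and dF_\<xi>: "x \<in> U \<Longrightarrow> dd F (\<xi> x) x \<bullet> dd F u x = \<eta> x u" and \<eta>_\<xi>: "x \<in> U \<Longrightarrow> \<eta> x (\<xi> x) = 1"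
    and second_form_eq: "x \<in> U \<Longrightarrow>
      dd (dd F v) u x \<bullet> N x = \<alpha> x * (dd F u x \<bullet> dd F v x) + \<beta> x * (\<eta> x u * \<eta> x v)"
begin

text \<open>The Weingarten equation.\<close>

lemma dN_eq:
  assumes x: "x \<in> U"
  shows "dd N u x = - (\<alpha> x *\<^sub>R dd F u x) - (\<beta> x * \<eta> x u) *\<^sub>R dd F (\<xi> x) x"
proof -
  have "dd N u x + \<alpha> x *\<^sub>R dd F u x + (\<beta> x * \<eta> x u) *\<^sub>R dd F (\<xi> x) x = 0"
    by (rule eq_0_if_orthogonal[OF x])
      (use dN_F[OF x] dN_N[OF x] F_dF[OF x] N_dF[OF x] dN_dF[OF x] second_form_eq[OF x] dF_\<xi>[OF x] in
        \<open>auto simp: inner_expand inner_commute\<close>)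
  then show ?thesis by (simp add: algebra_simps eq_neg_iff_add_eq_0)
qed

end

text \<open>\<open>u\<^sub>0\<close> is a constant direction transverse to ker eta on all of U.
  Dividing by the value of the form on it recovers B from a differential of the shape omega
  B.\<close>

locale focal_patch = quasi_umbilical_patch U F N c \<alpha> \<beta> \<eta> \<xi>
  for U :: "'a::euclidean_space set" and F N :: "'a \<Rightarrow> 'b::euclidean_space" and c :: real
    and \<alpha> \<beta> :: "'a \<Rightarrow> real" and \<eta> :: "'a \<Rightarrow> 'a \<Rightarrow> real" and \<xi> :: "'a \<Rightarrow> 'a" +
  fixes u\<^sub>0 :: 'a
  assumes \<alpha>_pos: "x \<in> U \<Longrightarrow> \<alpha> x > 0" and \<beta>_pos: "x \<in> U \<Longrightarrow> \<beta> x > 0"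
    and \<eta>_u0_pos: "x \<in> U \<Longrightarrow> \<eta> x u\<^sub>0 > 0"
begin

section \<open>The Codazzi equation and its consequences\<close>

definition "\<omega> x u = \<beta> x * \<eta> x u"

text \<open>For fields \<open>A\<close> with differential \<open>\<omega> \<otimes> B\<close>, the function \<open>along A\<close> is \<open>B\<close>.\<close>

definition along :: "('a \<Rightarrow> 'c::euclidean_space) \<Rightarrow> 'a \<Rightarrow> 'c" where
  "along A x = inverse (\<omega> x u\<^sub>0) *\<^sub>R dd A u\<^sub>0 x"

lemma \<omega>_u0_pos: "x \<in> U \<Longrightarrow> \<omega> x u\<^sub>0 > 0"
  using \<beta>_pos \<eta>_u0_pos by (simp add: \<omega>_def)

lemma smooth_\<omega>: "smooth_on U (\<lambda>x. \<omega> x u)"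
  unfolding \<omega>_def by (intro smooth_on_mult open_U smooth_\<beta> smooth_\<eta>)

lemma linear_\<omega>: "x \<in> U \<Longrightarrow> linear (\<omega> x)"
  using linear_compose_scale_right[OF linear_\<eta>, of x "\<beta> x"] by (simp add: \<omega>_def[abs_def])

lemma smooth_along: "smooth_on U A \<Longrightarrow> smooth_on U (along A)"
  unfolding along_def
  by (intro smooth_on_scaleR smooth_on_inverse open_U smooth_\<omega> smooth_on_dd \<omega>_u0_pos)

definition "E x = N x + \<alpha> x *\<^sub>R F x"

lemma smooth_E: "smooth_on U E"
  unfolding E_def by (intro smooth_on_add smooth_on_scaleR open_U smooth_N smooth_\<alpha> smooth_F)

text \<open>Adding \<open>\<alpha> F\<close> to N cancels the umbilical part of the Weingarten
  equation, so only a rank-one term and the differential of \<open>\<alpha>\<close> survive.\<close>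

lemma dE_\<xi>:
  assumes x: "x \<in> U"
  shows "dd E u x = dd \<alpha> u x *\<^sub>R F x - \<omega> x u *\<^sub>R dd F (\<xi> x) x"
  unfolding E_def
  using dd_add[OF smooth_N smooth_on_scaleR[OF open_U smooth_\<alpha> smooth_F] x, of u]
    dd_scaleR[OF smooth_\<alpha> smooth_F x, of u] dN_eq[OF x, of u]
  by (simp add: \<omega>_def)

text \<open>\<open>X\<close> is \<open>dF \<xi>\<close>, written such that it is manifestly smooth.\<close>

definition "X x = along \<alpha> x *\<^sub>R F x - along E x"

lemma smooth_X: "smooth_on U X"
  unfolding X_def
  by (intro smooth_on_diff smooth_on_scaleR smooth_along open_U smooth_\<alpha> smooth_F smooth_E)

lemma X_eq: "x \<in> U \<Longrightarrow> X x = dd F (\<xi> x) x"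
  using \<omega>_u0_pos[of x] by (simp add: X_def along_def dE_\<xi> scaleR_diff_right)

lemma dE: "x \<in> U \<Longrightarrow> dd E u x = dd \<alpha> u x *\<^sub>R F x - \<omega> x u *\<^sub>R X x"
  by (simp add: dE_\<xi> X_eq)

lemma X_dF: "x \<in> U \<Longrightarrow> X x \<bullet> dd F u x = \<eta> x u"
  by (simp add: X_eq dF_\<xi>)

lemma X_F: "x \<in> U \<Longrightarrow> X x \<bullet> F x = 0"
  using F_dF by (simp add: X_eq inner_commute)

lemma X_N: "x \<in> U \<Longrightarrow> X x \<bullet> N x = 0"
  using N_dF by (simp add: X_eq inner_commute)

lemma X_X: "x \<in> U \<Longrightarrow> X x \<bullet> X x = 1"
  by (simp add: X_eq dF_\<xi> \<eta>_\<xi>)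

lemma dX_X: "x \<in> U \<Longrightarrow> dd X u x \<bullet> X x = 0"
  using inner_deriv_eq[OF smooth_X smooth_X, of "\<lambda>_. 1" x u] X_X by (simp add: inner_commute)

text \<open>Both orders of differentiating E agree. The components along F cancel by the same
  symmetry for \<open>\<alpha>\<close>.\<close>

lemma codazzi:
  assumes x: "x \<in> U"
  shows "dd \<alpha> u x *\<^sub>R dd F v x - dd \<alpha> v x *\<^sub>R dd F u x
    - (dd (\<lambda>z. \<omega> z u) v x - dd (\<lambda>z. \<omega> z v) u x) *\<^sub>R X x
    - \<omega> x u *\<^sub>R dd X v x + \<omega> x v *\<^sub>R dd X u x = 0"
proof -
  have d: "dd (dd E u) v x = dd \<alpha> u x *\<^sub>R dd F v x + dd (dd \<alpha> u) v x *\<^sub>R F x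
      - (\<omega> x u *\<^sub>R dd X v x + dd (\<lambda>z. \<omega> z u) v x *\<^sub>R X x)" for u v
  proof -
    have "dd (dd E u) v x = dd (\<lambda>z. dd \<alpha> u z *\<^sub>R F z - \<omega> z u *\<^sub>R X z) v x"
      by (rule fun_cong[OF dd_cong[OF open_U x dE]])
    also have "\<dots> = dd (\<lambda>z. dd \<alpha> u z *\<^sub>R F z) v x - dd (\<lambda>z. \<omega> z u *\<^sub>R X z) v x"
      by (rule dd_diff[OF _ _ x])
        (intro smooth_on_scaleR open_U smooth_on_dd smooth_\<alpha> smooth_F smooth_X smooth_\<omega>)+
    finally show ?thesis
      using dd_scaleR[OF smooth_on_dd[OF smooth_\<alpha>] smooth_F x] dd_scaleR[OF smooth_\<omega> smooth_X x]
      by simp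
  qed
  show ?thesis
    using d[of u v] d[of v u] dd_symmetric[OF open_U smooth_E x, of u v]
      dd_symmetric[OF open_U smooth_\<alpha> x, of u v]
    by (simp add: algebra_simps)
qed

text \<open>Since the dimension exceeds 2, ker eta contains v orthogonal to u. In the product of the
  Codazzi equation with \<open>dd F v x\<close>, only the term with \<open>dd \<alpha> u x\<close>
  remains.\<close>

lemma d\<alpha>_ker:
  assumes x: "x \<in> U" and u: "\<eta> x u = 0"
  shows "dd \<alpha> u x = 0"
proof -
  have "linear (\<lambda>v. dd F u x \<bullet> dd F v x)"
    using linear_compose[OF linear_dd_smooth[OF smooth_F x] bounded_linear.linear[OF bounded_linear_inner_right]]
    by (simp add: o_def)
  then obtain v where v: "v \<noteq> 0" "\<eta> x v = 0" "dd F u x \<bullet> dd F v x = 0"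
    using common_kernel_vector[OF linear_\<eta>[OF x] _ dim_gt_2] by metis
  have "0 \<bullet> dd F v x = dd \<alpha> u x * (dd F v x \<bullet> dd F v x)"
    unfolding codazzi[OF x, of u v, symmetric]
    using u v X_dF[OF x] by (simp add: inner_diff_left inner_add_left \<omega>_def)
  then show ?thesis using dF_inj[OF x, of v] v(1) by auto
qed

text \<open>In the product of the Codazzi equation with X, the terms with the differential of
  \<open>\<alpha>\<close> cancel, because that differential is a multiple of
  \<open>\<eta>\<close>.\<close>

lemma closed_\<omega>:
  assumes x: "x \<in> U"
  shows "dd (\<lambda>z. \<omega> z u) v x = dd (\<lambda>z. \<omega> z v) u x"
proof -
  have l: "linear (\<lambda>u. dd \<alpha> u x)" by (rule linear_dd_smooth[OF smooth_\<alpha> x])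
  have "\<eta> x (u - \<eta> x u *\<^sub>R \<xi> x) = 0" for u
    using \<eta>_\<xi>[OF x] by (simp add: linear_diff[OF linear_\<eta>[OF x]] linear_cmul[OF linear_\<eta>[OF x]])
  then have d\<alpha>: "dd \<alpha> u x = \<eta> x u * dd \<alpha> (\<xi> x) x" for u
    using d\<alpha>_ker[OF x, of "u - \<eta> x u *\<^sub>R \<xi> x"] by (simp add: linear_diff[OF l] linear_cmul[OF l])
  have "0 \<bullet> X x = dd \<alpha> u x * \<eta> x v - dd \<alpha> v x * \<eta> x u
      - (dd (\<lambda>z. \<omega> z u) v x - dd (\<lambda>z. \<omega> z v) u x)"
    unfolding codazzi[OF x, of u v, symmetric]
    using X_dF[OF x] X_X[OF x] dX_X[OF x] by (simp add: inner_expand inner_commute)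
  then show ?thesis by (simp add: d\<alpha>[of u] d\<alpha>[of v])
qed

text \<open>Symmetry of the second derivatives of A and closedness of \<open>\<omega>\<close> give
  \<open>\<omega> u dB(v) = \<omega> v dB(u)\<close>; taking v to be \<open>u\<^sub>0\<close> shows
  that dB is again a multiple of \<open>\<omega>\<close>. Hence the passage from A to
  \<open>along A\<close> can be iterated.\<close>

lemma along_eq:
  fixes A B :: "'a \<Rightarrow> 'c::euclidean_space"
  assumes A: "smooth_on U A" and B: "smooth_on U B"
    and d: "\<And>z u. z \<in> U \<Longrightarrow> dd A u z = \<omega> z u *\<^sub>R B z" and x: "x \<in> U"
  shows "dd B u x = \<omega> x u *\<^sub>R along B x"
proof -
  have dd_d: "dd (dd A u) v x = \<omega> x u *\<^sub>R dd B v x + dd (\<lambda>z. \<omega> z u) v x *\<^sub>R B x" for u v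
    using dd_cong[OF open_U x, of "dd A u" "\<lambda>z. \<omega> z u *\<^sub>R B z"] d dd_scaleR[OF smooth_\<omega> B x] by simp
  have "\<omega> x u *\<^sub>R dd B u\<^sub>0 x = \<omega> x u\<^sub>0 *\<^sub>R dd B u x"
    using dd_d[of u u\<^sub>0] dd_d[of u\<^sub>0 u] dd_symmetric[OF open_U A x] closed_\<omega>[OF x] by (metis add_right_cancel)
  then have "inverse (\<omega> x u\<^sub>0) *\<^sub>R \<omega> x u *\<^sub>R dd B u\<^sub>0 x = dd B u x"
    using \<omega>_u0_pos[OF x] by simp
  then show ?thesis by (simp add: along_def mult.commute)
qed

section \<open>Derivatives of the enveloped hyperspheres\<close>

definition "\<rho> = along \<alpha>"
definition "\<sigma> = along \<rho>"
definition "F\<^sub>1 = along E"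
definition "F\<^sub>2 = along F\<^sub>1"

lemma smooth_focal: "smooth_on U \<rho>" "smooth_on U \<sigma>" "smooth_on U F\<^sub>1" "smooth_on U F\<^sub>2"
  unfolding \<rho>_def \<sigma>_def F\<^sub>1_def F\<^sub>2_def by (intro smooth_along smooth_\<alpha> smooth_E)+

lemma d\<alpha>:
  assumes x: "x \<in> U"
  shows "dd \<alpha> u x = \<omega> x u * \<rho> x"
proof -
  have l: "linear (\<lambda>u. dd \<alpha> u x)" by (rule linear_dd_smooth[OF smooth_\<alpha> x])
  have "\<eta> x (u - (\<eta> x u / \<eta> x u\<^sub>0) *\<^sub>R u\<^sub>0) = 0"
    using \<eta>_u0_pos[OF x] by (simp add: linear_diff[OF linear_\<eta>[OF x]] linear_cmul[OF linear_\<eta>[OF x]])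
  from d\<alpha>_ker[OF x this] have "dd \<alpha> u x = (\<eta> x u / \<eta> x u\<^sub>0) * dd \<alpha> u\<^sub>0 x"
    by (simp add: linear_diff[OF l] linear_cmul[OF l])
  then show ?thesis using \<beta>_pos[OF x] \<eta>_u0_pos[OF x] by (simp add: \<rho>_def along_def \<omega>_def field_simps)
qed

lemma F1_eq: "F\<^sub>1 x = \<rho> x *\<^sub>R F x - X x"
  by (simp add: X_def F\<^sub>1_def \<rho>_def)

lemma dE_F1: "x \<in> U \<Longrightarrow> dd E u x = \<omega> x u *\<^sub>R F\<^sub>1 x"
  by (simp add: dE d\<alpha> F1_eq algebra_simps)

lemma dF1: "x \<in> U \<Longrightarrow> dd F\<^sub>1 u x = \<omega> x u *\<^sub>R F\<^sub>2 x"
  unfolding F\<^sub>2_def by (rule along_eq[OF smooth_E smooth_focal(3) dE_F1])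

lemma dF2: "x \<in> U \<Longrightarrow> dd F\<^sub>2 u x = \<omega> x u *\<^sub>R along F\<^sub>2 x"
  by (rule along_eq[OF smooth_focal(3,4) dF1])

lemma d\<rho>: "x \<in> U \<Longrightarrow> dd \<rho> u x = \<omega> x u * \<sigma> x"
  using along_eq[OF smooth_\<alpha> smooth_focal(1), of x u] d\<alpha> by (simp add: \<sigma>_def)

lemma d\<sigma>: "x \<in> U \<Longrightarrow> dd \<sigma> u x = \<omega> x u * along \<sigma> x"
  using along_eq[OF smooth_focal(1,2), of x u] d\<rho> by simp

lemma F1_F: "x \<in> U \<Longrightarrow> F\<^sub>1 x \<bullet> F x = \<rho> x * inverse c"
  by (simp add: F1_eq inner_diff_left X_F F_F divide_inverse)

lemma F1_F1: "x \<in> U \<Longrightarrow> F\<^sub>1 x \<bullet> F\<^sub>1 x = \<rho> x * \<rho> x * inverse c + 1"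
  using X_F[of x] by (simp add: F1_eq X_X F_F divide_inverse inner_expand inner_commute)

lemma F1_E: "x \<in> U \<Longrightarrow> F\<^sub>1 x \<bullet> E x = \<alpha> x * \<rho> x * inverse c"
  using N_F[of x] X_F[of x] X_N[of x] by (simp add: F1_eq E_def F_F divide_inverse inner_expand inner_commute)

lemma F1_dF: "x \<in> U \<Longrightarrow> F\<^sub>1 x \<bullet> dd F u x = - \<eta> x u"
  by (simp add: F1_eq inner_diff_left F_dF X_dF)

text \<open>\<open>F1_F\<close> is differentiated along \<open>u\<^sub>0\<close> and divided by
  \<open>\<omega> x u\<^sub>0\<close>. The summand \<open>inverse (\<beta> x)\<close> arises from
  \<open>F1_dF\<close>, as the quotient of \<open>\<eta>\<close> by \<open>\<omega>\<close>. Solved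
  for it, this is the affine expression for 1 / beta on a leaf.\<close>

lemma F2_F:
  assumes x: "x \<in> U"
  shows "F\<^sub>2 x \<bullet> F x = \<sigma> x * inverse c + inverse (\<beta> x)"
proof -
  have "F\<^sub>1 x \<bullet> dd F u\<^sub>0 x + dd F\<^sub>1 u\<^sub>0 x \<bullet> F x = dd (\<lambda>x. \<rho> x * inverse c) u\<^sub>0 x"
    by (rule inner_deriv_eq[OF smooth_focal(3) smooth_F F1_F x])
  moreover have "\<omega> x u\<^sub>0 * inverse (\<beta> x) = \<eta> x u\<^sub>0"
    using \<beta>_pos[OF x] by (simp add: \<omega>_def)
  ultimately have "\<omega> x u\<^sub>0 * (F\<^sub>2 x \<bullet> F x) = \<omega> x u\<^sub>0 * (\<sigma> x * inverse c + inverse (\<beta> x))"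
    unfolding dd_mult[OF smooth_focal(1) smooth_on_const x] F1_dF[OF x] dF1[OF x] d\<rho>[OF x]
    by (simp add: distrib_left)
  then show ?thesis using \<omega>_u0_pos[OF x] by simp
qed

lemma F2_F1:
  assumes x: "x \<in> U"
  shows "F\<^sub>2 x \<bullet> F\<^sub>1 x = \<rho> x * \<sigma> x * inverse c"
proof -
  note s = smooth_on_mult[OF open_U smooth_focal(1) smooth_focal(1)]
  have "F\<^sub>1 x \<bullet> dd F\<^sub>1 u\<^sub>0 x + dd F\<^sub>1 u\<^sub>0 x \<bullet> F\<^sub>1 x = dd (\<lambda>x. \<rho> x * \<rho> x * inverse c + 1) u\<^sub>0 x"
    by (rule inner_deriv_eq[OF smooth_focal(3) smooth_focal(3) F1_F1 x])
  also have "\<dots> = dd (\<lambda>x. \<rho> x * \<rho> x) u\<^sub>0 x * inverse c"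
    using dd_add[OF smooth_on_mult[OF open_U s smooth_on_const] smooth_on_const x, of "inverse c" 1 u\<^sub>0]
      dd_mult[OF s smooth_on_const x, of "inverse c" u\<^sub>0] by simp
  also have "dd (\<lambda>x. \<rho> x * \<rho> x) u\<^sub>0 x = 2 * (\<omega> x u\<^sub>0 * (\<rho> x * \<sigma> x))"
    using dd_mult[OF smooth_focal(1) smooth_focal(1) x, of u\<^sub>0] d\<rho>[OF x] by simp
  finally have "\<omega> x u\<^sub>0 * (F\<^sub>2 x \<bullet> F\<^sub>1 x) = \<omega> x u\<^sub>0 * (\<rho> x * \<sigma> x * inverse c)"
    unfolding dF1[OF x] by (simp add: inner_commute mult.assoc)
  then show ?thesis using \<omega>_u0_pos[OF x] by simp
qed

text \<open>Obtained by differentiating \<open>F1_E\<close>; the constant - 1 stems from the unit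
  length of X inside \<open>F1_F1\<close>.\<close>

lemma F2_E:
  assumes x: "x \<in> U"
  shows "F\<^sub>2 x \<bullet> E x = \<alpha> x * \<sigma> x * inverse c - 1"
proof -
  note s = smooth_on_mult[OF open_U smooth_\<alpha> smooth_focal(1)]
  have "F\<^sub>1 x \<bullet> dd E u\<^sub>0 x + dd F\<^sub>1 u\<^sub>0 x \<bullet> E x = dd (\<lambda>x. \<alpha> x * \<rho> x * inverse c) u\<^sub>0 x"
    by (rule inner_deriv_eq[OF smooth_focal(3) smooth_E F1_E x])
  also have "\<dots> = dd (\<lambda>x. \<alpha> x * \<rho> x) u\<^sub>0 x * inverse c"
    using dd_mult[OF s smooth_on_const x, of "inverse c" u\<^sub>0] by simp
  also have "dd (\<lambda>x. \<alpha> x * \<rho> x) u\<^sub>0 x = \<omega> x u\<^sub>0 * (\<alpha> x * \<sigma> x + \<rho> x * \<rho> x)"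
    using dd_mult[OF smooth_\<alpha> smooth_focal(1) x, of u\<^sub>0] d\<rho>[OF x] d\<alpha>[OF x] by (simp add: algebra_simps)
  finally have "\<omega> x u\<^sub>0 * (F\<^sub>2 x \<bullet> E x + F\<^sub>1 x \<bullet> F\<^sub>1 x) = \<omega> x u\<^sub>0 * ((\<alpha> x * \<sigma> x + \<rho> x * \<rho> x) * inverse c)"
    using dF1[OF x] dE_F1[OF x] by (simp add: inner_commute algebra_simps)
  then have "F\<^sub>2 x \<bullet> E x + F\<^sub>1 x \<bullet> F\<^sub>1 x = (\<alpha> x * \<sigma> x + \<rho> x * \<rho> x) * inverse c"
    using \<omega>_u0_pos[OF x] by simp
  then show ?thesis using F1_F1[OF x] by (simp add: algebra_simps)
qed

section \<open>Derivatives of the penalized function\<close>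

lemma smooth_inverse_\<beta>: "smooth_on U (\<lambda>x. inverse (\<beta> x))"
  by (intro smooth_on_inverse open_U smooth_\<beta> \<beta>_pos)

text \<open>The coefficient of \<open>\<omega>\<close> in the differential of the penalized
  function: it gathers the change of \<open>\<alpha>\<close> and that of the coefficients of the
  affine function across the leaves.\<close>

definition "\<mu> e x = \<rho> x + e * (along F\<^sub>2 x \<bullet> F x - along \<sigma> x * inverse c)"

lemma smooth_\<mu>: "smooth_on U (\<mu> e)"
  unfolding \<mu>_def
  by (intro smooth_on_add smooth_on_mult smooth_on_diff smooth_on_inner smooth_along smooth_focal
      smooth_F smooth_on_const open_U)

lemma smooth_penalized: "smooth_on U (\<lambda>x. \<alpha> x + e * inverse (\<beta> x))"
  by (intro smooth_on_add smooth_on_mult smooth_on_const smooth_inverse_\<beta> smooth_\<alpha> open_U)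

text \<open>By \<open>F2_F\<close>, 1 / beta is \<open>F\<^sub>2 . F - \<sigma> / c\<close>. The
  differentials of \<open>F\<^sub>2\<close> and \<open>\<sigma>\<close> are multiples of
  \<open>\<omega>\<close> and go into \<open>\<mu>\<close>.\<close>

lemma d_penalized:
  assumes x: "x \<in> U"
  shows "dd (\<lambda>x. \<alpha> x + e * inverse (\<beta> x)) u x = \<mu> e x * \<omega> x u + e * (F\<^sub>2 x \<bullet> dd F u x)"
proof -
  note s = smooth_on_inner[OF open_U smooth_focal(4) smooth_F]
    and s' = smooth_on_mult[OF open_U smooth_focal(2) smooth_on_const[of U "inverse c"]]
  have "dd (\<lambda>x. inverse (\<beta> x)) u x = dd (\<lambda>x. F\<^sub>2 x \<bullet> F x - \<sigma> x * inverse c) u x"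
    using dd_cong[OF open_U x, of "\<lambda>x. inverse (\<beta> x)" "\<lambda>x. F\<^sub>2 x \<bullet> F x - \<sigma> x * inverse c"] F2_F by simp
  also have "\<dots> = dd (\<lambda>x. F\<^sub>2 x \<bullet> F x) u x - dd (\<lambda>x. \<sigma> x * inverse c) u x"
    by (rule dd_diff[OF s s' x])
  also have "\<dots> = F\<^sub>2 x \<bullet> dd F u x + \<omega> x u * (along F\<^sub>2 x \<bullet> F x) - \<omega> x u * along \<sigma> x * inverse c"
    using dd_inner[OF smooth_focal(4) smooth_F x, of u] dF2[OF x]
      dd_mult[OF smooth_focal(2) smooth_on_const x, of "inverse c" u] d\<sigma>[OF x] by simp
  finally have i: "dd (\<lambda>x. inverse (\<beta> x)) u x = \<dots>" .
  have "dd (\<lambda>x. \<alpha> x + e * inverse (\<beta> x)) u x = dd \<alpha> u x + e * dd (\<lambda>x. inverse (\<beta> x)) u x"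
    using dd_add[OF smooth_\<alpha> smooth_on_mult[OF open_U smooth_on_const smooth_inverse_\<beta>] x, of e u]
      dd_mult[OF smooth_on_const smooth_inverse_\<beta> x, of e u] by simp
  then show ?thesis unfolding i d\<alpha>[OF x] \<mu>_def by (simp add: algebra_simps)
qed

text \<open>The constant field v lies in ker eta at x but in general not nearby. The derivative of
  \<open>\<omega> z v\<close> corrects for this; it is found by writing \<open>\<omega> z v\<close>
  as \<open>- \<beta> F\<^sub>1 . dF v\<close>, whence the term with
  \<open>F\<^sub>1\<close>.\<close>

lemma dd_penalized_ker:
  assumes x: "x \<in> U" and v: "\<eta> x v = 0"
  shows "dd (dd (\<lambda>x. \<alpha> x + e * inverse (\<beta> x)) v) v x
    = (e *\<^sub>R F\<^sub>2 x - (\<mu> e x * \<beta> x) *\<^sub>R F\<^sub>1 x) \<bullet> dd (dd F v) v x"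
proof -
  have \<omega>v: "\<omega> x v = 0" using v by (simp add: \<omega>_def)
  note s = smooth_on_inner[OF open_U smooth_focal(3) smooth_on_dd[OF smooth_F, of v]]
    and s' = smooth_on_inner[OF open_U smooth_focal(4) smooth_on_dd[OF smooth_F, of v]]
  have "dd (\<lambda>z. \<omega> z v) v x = dd (\<lambda>z. - (\<beta> z * (F\<^sub>1 z \<bullet> dd F v z))) v x"
    using dd_cong[OF open_U x, of "\<lambda>z. \<omega> z v" "\<lambda>z. - (\<beta> z * (F\<^sub>1 z \<bullet> dd F v z))"] F1_dF
    by (simp add: \<omega>_def)
  also have "\<dots> = - dd (\<lambda>z. \<beta> z * (F\<^sub>1 z \<bullet> dd F v z)) v x"
    by (rule dd_uminus[OF smooth_on_mult[OF open_U smooth_\<beta> s] x])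
  also have "\<dots> = - (\<beta> x * (F\<^sub>1 x \<bullet> dd (dd F v) v x))"
    using dd_mult[OF smooth_\<beta> s x, of v] F1_dF[OF x] v dF1[OF x] \<omega>v
      dd_inner[OF smooth_focal(3) smooth_on_dd[OF smooth_F] x, of v v] by simp
  finally have d\<omega>: "dd (\<lambda>z. \<omega> z v) v x = \<dots>" .
  have "dd (dd (\<lambda>x. \<alpha> x + e * inverse (\<beta> x)) v) v x
      = dd (\<lambda>z. \<mu> e z * \<omega> z v + e * (F\<^sub>2 z \<bullet> dd F v z)) v x"
    using dd_cong[OF open_U x d_penalized] by simp
  also have "\<dots> = dd (\<lambda>z. \<mu> e z * \<omega> z v) v x + dd (\<lambda>z. e * (F\<^sub>2 z \<bullet> dd F v z)) v x"
    by (rule dd_add[OF smooth_on_mult[OF open_U smooth_\<mu> smooth_\<omega>]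
          smooth_on_mult[OF open_U smooth_on_const s'] x])
  also have "\<dots> = \<mu> e x * dd (\<lambda>z. \<omega> z v) v x + e * (F\<^sub>2 x \<bullet> dd (dd F v) v x)"
    using dd_mult[OF smooth_\<mu> smooth_\<omega> x, of e v v] \<omega>v dd_mult[OF smooth_on_const s' x, of e v]
      dd_inner[OF smooth_focal(4) smooth_on_dd[OF smooth_F] x, of v v] dF2[OF x] by simp
  finally show ?thesis unfolding d\<omega> by (simp add: inner_diff_left)
qed

text \<open>In the directions of \<open>ker \<eta>\<close>, the first and second derivatives of the penalized function are
  those of a linear function on the ambient space, whose gradient \<open>Q\<close> is normal at the minimum.\<close>

lemma \<sigma>_le_at_minimum:
  assumes x: "x \<in> U" and e: "e > 0"
    and min: "\<And>y. y \<in> U \<Longrightarrow> \<alpha> x + e * inverse (\<beta> x) \<le> \<alpha> y + e * inverse (\<beta> y)"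
  shows "\<sigma> x \<le> - (c * inverse (\<beta> x))"
proof -
  define Q where "Q = e *\<^sub>R F\<^sub>2 x - (\<mu> e x * \<beta> x) *\<^sub>R F\<^sub>1 x"
  note m = minimum_second_order[OF open_U smooth_penalized x min]
  have Q_dF: "Q \<bullet> dd F u x = 0" for u
    using m(1)[of u] d_penalized[OF x, of e u] F1_dF[OF x, of u]
    by (simp add: Q_def inner_diff_left \<omega>_def)
  have "Q - (Q \<bullet> N x) *\<^sub>R N x - (c * (Q \<bullet> F x)) *\<^sub>R F x = 0"
    by (rule eq_0_if_orthogonal[OF x])
      (use Q_dF N_F[OF x] F_F[OF x] N_N[OF x] N_dF[OF x] F_dF[OF x] c_pos in
        \<open>auto simp: inner_expand inner_commute\<close>)
  then have Q: "Q = (Q \<bullet> N x) *\<^sub>R N x + (c * (Q \<bullet> F x)) *\<^sub>R F x" by (simp add: algebra_simps)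
  obtain v where v: "v \<noteq> 0" "\<eta> x v = 0"
    using common_kernel_vector[OF linear_\<eta>[OF x] linear_\<eta>[OF x] dim_gt_2] by metis
  have "0 \<le> Q \<bullet> dd (dd F v) v x"
    using m(2)[of v] dd_penalized_ker[OF x v(2)] by (simp add: Q_def)
  also have "\<dots> = (dd F v x \<bullet> dd F v x) * (\<alpha> x * (Q \<bullet> N x) - c * (Q \<bullet> F x))"
    using second_form_eq[OF x, of v v] ddF_F[OF x, of v v] v(2)
    by (subst Q) (simp add: inner_expand inner_commute algebra_simps)
  finally have "0 \<le> (dd F v x \<bullet> dd F v x) * (\<alpha> x * (Q \<bullet> N x) - c * (Q \<bullet> F x))" .
  moreover have "dd F v x \<bullet> dd F v x > 0" using dF_inj[OF x] v(1) by auto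
  ultimately have "0 \<le> \<alpha> x * (Q \<bullet> N x) - c * (Q \<bullet> F x)" by (simp add: zero_le_mult_iff)
  \<comment> \<open>The products of Q with E and F are known from \<open>F2_E\<close>,
    \<open>F1_E\<close>, \<open>F2_F\<close> and \<open>F1_F\<close>, so N is eliminated in favour
    of E.\<close>
  moreover have "N x = E x - \<alpha> x *\<^sub>R F x" by (simp add: E_def)
  ultimately have "0 \<le> \<alpha> x * (Q \<bullet> E x) - (\<alpha> x * \<alpha> x + c) * (Q \<bullet> F x)"
    by (simp add: inner_diff_right algebra_simps)
  also have "\<dots> = \<mu> e x * \<beta> x * \<rho> x - e * (\<alpha> x + \<sigma> x + (\<alpha> x * \<alpha> x + c) * inverse (\<beta> x))"
  proof -
    have c: "c * (inverse c * t) = t" "c * (s * (inverse c * t)) = s * t" for s t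
      using c_pos by (simp_all add: field_simps)
    show ?thesis
      unfolding Q_def inner_diff_left inner_scaleR_left F2_E[OF x] F1_E[OF x] F2_F[OF x] F1_F[OF x]
      by (simp add: algebra_simps c)
  qed
  finally have 1: "0 \<le> \<mu> e x * \<beta> x * \<rho> x - e * (\<alpha> x + \<sigma> x + (\<alpha> x * \<alpha> x + c) * inverse (\<beta> x))" .
  \<comment> \<open>The first-order condition in the direction of \<open>\<xi>\<close> eliminates
    \<open>\<mu>\<close>; the first term of the estimate then becomes
    \<open>- e \<rho>\<^sup>2 / \<beta>\<close>, which has the favourable sign.\<close>
  have "Q \<bullet> X x = 0" using Q_dF X_eq[OF x] by simp
  moreover have "X x = \<rho> x *\<^sub>R F x - F\<^sub>1 x" by (simp add: F1_eq)
  ultimately have 2: "\<mu> e x * \<beta> x = - (e * \<rho> x * inverse (\<beta> x))"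
    using F2_F1[OF x] F1_F1[OF x] F2_F[OF x] F1_F[OF x]
    by (simp add: Q_def inner_diff_left inner_diff_right algebra_simps)
  have "0 \<le> - (e * (\<rho> x * \<rho> x * inverse (\<beta> x) + \<alpha> x + \<sigma> x + (\<alpha> x * \<alpha> x + c) * inverse (\<beta> x)))"
    using 1 unfolding 2 by (simp add: algebra_simps)
  then have "\<rho> x * \<rho> x * inverse (\<beta> x) + \<alpha> x + \<sigma> x + (\<alpha> x * \<alpha> x + c) * inverse (\<beta> x) \<le> 0"
    using e by (simp add: mult_le_0_iff)
  moreover have "0 \<le> \<rho> x * \<rho> x * inverse (\<beta> x)" "0 \<le> \<alpha> x * \<alpha> x * inverse (\<beta> x)"
    using \<beta>_pos[OF x] by simp_all
  ultimately show ?thesis using \<alpha>_pos[OF x] by (simp add: distrib_right)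
qed

text \<open>The coefficient of e in the second derivative of the penalized function along
  \<open>u\<^sub>0\<close>, once \<open>\<rho>\<close> has been eliminated by the first-order
  condition. It does not involve e.\<close>

definition "err x = dd (dd (\<lambda>x. inverse (\<beta> x)) u\<^sub>0) u\<^sub>0 x
  - dd (\<lambda>x. inverse (\<beta> x)) u\<^sub>0 x * inverse (\<omega> x u\<^sub>0) * dd (\<lambda>x. \<omega> x u\<^sub>0) u\<^sub>0 x"

lemma smooth_err: "smooth_on U err"
  unfolding err_def
  by (intro smooth_on_diff smooth_on_mult smooth_on_inverse smooth_on_dd smooth_inverse_\<beta> smooth_\<omega>
      \<omega>_u0_pos open_U)

text \<open>At the minimum \<open>\<rho>\<close> is of order e, so the second derivative across the
  leaves is \<open>\<omega>\<^sup>2 \<sigma> + e err\<close>. It is nonnegative, while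
  \<open>\<sigma>\<close> is bounded above by a negative quantity independent of e.\<close>

lemma err_at_minimum:
  assumes x: "x \<in> U" and e: "e > 0"
    and min: "\<And>y. y \<in> U \<Longrightarrow> \<alpha> x + e * inverse (\<beta> x) \<le> \<alpha> y + e * inverse (\<beta> y)"
  shows "c * inverse (\<beta> x) * (\<omega> x u\<^sub>0 * \<omega> x u\<^sub>0) \<le> e * err x"
proof -
  note m = minimum_second_order[OF open_U smooth_penalized x min]
  note ie = smooth_on_mult[OF open_U smooth_on_const smooth_inverse_\<beta>, of e]
  have d: "dd (\<lambda>x. \<alpha> x + e * inverse (\<beta> x)) u z = \<omega> z u * \<rho> z + e * dd (\<lambda>x. inverse (\<beta> x)) u z" if z: "z \<in> U" for u z
    using dd_add[OF smooth_\<alpha> ie z] d\<alpha>[OF z] dd_mult[OF smooth_on_const smooth_inverse_\<beta> z, of e u] by simp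
  have 1: "\<rho> x * \<omega> x u\<^sub>0 = - (e * dd (\<lambda>x. inverse (\<beta> x)) u\<^sub>0 x)"
    using m(1)[of u\<^sub>0] unfolding d[OF x] by (simp add: mult.commute eq_neg_iff_add_eq_0)
  have "0 \<le> dd (dd (\<lambda>x. \<alpha> x + e * inverse (\<beta> x)) u\<^sub>0) u\<^sub>0 x" by (rule m(2))
  also have "\<dots> = dd (\<lambda>z. \<omega> z u\<^sub>0 * \<rho> z + e * dd (\<lambda>x. inverse (\<beta> x)) u\<^sub>0 z) u\<^sub>0 x"
    using dd_cong[OF open_U x d] by simp
  also have "\<dots> = dd (\<lambda>z. \<omega> z u\<^sub>0 * \<rho> z) u\<^sub>0 x + dd (\<lambda>z. e * dd (\<lambda>x. inverse (\<beta> x)) u\<^sub>0 z) u\<^sub>0 x"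
    by (rule dd_add[OF smooth_on_mult[OF open_U smooth_\<omega> smooth_focal(1)]
          smooth_on_mult[OF open_U smooth_on_const smooth_on_dd[OF smooth_inverse_\<beta>]] x])
  also have "\<dots> = \<omega> x u\<^sub>0 * \<omega> x u\<^sub>0 * \<sigma> x + \<rho> x * dd (\<lambda>x. \<omega> x u\<^sub>0) u\<^sub>0 x
      + e * dd (dd (\<lambda>x. inverse (\<beta> x)) u\<^sub>0) u\<^sub>0 x"
    using dd_mult[OF smooth_\<omega> smooth_focal(1) x, of u\<^sub>0 u\<^sub>0] d\<rho>[OF x]
      dd_mult[OF smooth_on_const smooth_on_dd[OF smooth_inverse_\<beta>] x, of e u\<^sub>0 u\<^sub>0] by simp
  also have "\<rho> x = - (e * dd (\<lambda>x. inverse (\<beta> x)) u\<^sub>0 x * inverse (\<omega> x u\<^sub>0))"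
    using 1 \<omega>_u0_pos[OF x] by (simp add: field_simps)
  finally have "0 \<le> \<omega> x u\<^sub>0 * \<omega> x u\<^sub>0 * \<sigma> x + e * err x"
    by (simp add: err_def algebra_simps)
  moreover have "\<omega> x u\<^sub>0 * \<omega> x u\<^sub>0 * \<sigma> x \<le> \<omega> x u\<^sub>0 * \<omega> x u\<^sub>0 * - (c * inverse (\<beta> x))"
    by (rule mult_left_mono[OF \<sigma>_le_at_minimum[OF x e min]]) simp_all
  ultimately show ?thesis by (simp add: algebra_simps)
qed

lemma no_minimum_nearby:
  assumes "x\<^sub>0 \<in> U"
  obtains W \<delta> where "open W" "x\<^sub>0 \<in> W" "W \<subseteq> U" "\<delta> > 0"
    "\<And>e x. 0 < e \<Longrightarrow> e < \<delta> \<Longrightarrow> x \<in> W \<Longrightarrow>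
      \<exists>y\<in>U. \<alpha> y + e * inverse (\<beta> y) < \<alpha> x + e * inverse (\<beta> x)"
proof -
  define a where "a x = c * inverse (\<beta> x) * (\<omega> x u\<^sub>0 * \<omega> x u\<^sub>0)" for x
  \<comment> \<open>The summand 1 makes b positive and leaves room for \<open>err\<close> to vary
    near \<open>x\<^sub>0\<close>.\<close>
  define b where "b = \<bar>err x\<^sub>0\<bar> + 1"
  have a0: "a x\<^sub>0 > 0" using assms c_pos \<beta>_pos \<omega>_u0_pos by (simp add: a_def)
  have "smooth_on U a" unfolding a_def
    by (intro smooth_on_mult smooth_on_const smooth_inverse_\<beta> smooth_\<omega> open_U)
  then have ca: "continuous_on U a" by (rule smooth_on_continuous)
  have ce: "continuous_on U err" by (rule smooth_on_continuous[OF smooth_err])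
  define W where "W = (U \<inter> a -` {a x\<^sub>0 / 2 <..}) \<inter> (U \<inter> err -` {..< b})"
  have "open W"
    unfolding W_def using ca ce open_U
    by (intro open_Int continuous_open_preimage) auto
  moreover have "x\<^sub>0 \<in> W" using assms a0 by (simp add: W_def b_def)
  moreover have "W \<subseteq> U" by (auto simp: W_def)
  \<comment> \<open>This is \<open>\<delta>\<close>: for smaller e, \<open>e * b\<close> is below
    \<open>a x\<^sub>0 / 2\<close>, which is below a on W.\<close>
  moreover have "a x\<^sub>0 / (2 * b) > 0" using a0 by (simp add: b_def)
  moreover have "\<exists>y\<in>U. \<alpha> y + e * inverse (\<beta> y) < \<alpha> x + e * inverse (\<beta> x)"
    if e: "0 < e" "e < a x\<^sub>0 / (2 * b)" and x: "x \<in> W" for e x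
  proof (rule ccontr)
    assume "\<not> ?thesis"
    then have "a x \<le> e * err x"
      unfolding a_def using x e(1) by (intro err_at_minimum) (auto simp: W_def not_less)
    also have "\<dots> \<le> e * b" using x e(1) by (intro mult_left_mono) (auto simp: W_def)
    also have "\<dots> < a x\<^sub>0 / 2" using e(2) by (simp add: b_def field_simps)
    finally show False using x by (simp add: W_def)
  qed
  ultimately show thesis by (rule that)
qed

end

section \<open>Metrics induced by immersions, and real projective space\<close>

lemma smooth_on_prod:
  fixes f :: "'i \<Rightarrow> 'a::euclidean_space \<Rightarrow> real"
  assumes "open S"
  shows "finite I \<Longrightarrow> (\<And>i. i \<in> I \<Longrightarrow> smooth_on S (f i)) \<Longrightarrow> smooth_on S (\<lambda>x. \<Prod>i\<in>I. f i x)"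
  by (induction I rule: finite_induct) (auto intro!: smooth_on_const smooth_on_mult[OF assms])

lemma smooth_on_det:
  fixes A :: "'a::euclidean_space \<Rightarrow> real^'n^'n"
  assumes "open S" "\<And>i j. smooth_on S (\<lambda>x. A x $ i $ j)"
  shows "smooth_on S (\<lambda>x. det (A x))"
  unfolding det_def
  by (intro smooth_on_sum smooth_on_mult smooth_on_const smooth_on_prod assms) auto

lemma smooth_on_vec:
  fixes f :: "'a::euclidean_space \<Rightarrow> real^'n"
  assumes "open S" "\<And>i. smooth_on S (\<lambda>x. f x $ i)"
  shows "smooth_on S f"
proof -
  have eq: "f x = (\<Sum>i\<in>UNIV. f x $ i *\<^sub>R axis i 1)" for x
    using basis_expansion[of "f x"] by (simp add: scalar_mult_eq_scaleR)
  have s: "smooth_on S (\<lambda>x. \<Sum>i\<in>UNIV. f x $ i *\<^sub>R axis i 1)"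
    by (intro smooth_on_sum smooth_on_scaleR smooth_on_const assms) simp
  show ?thesis by (rule smooth_on_cong[OF assms(1), THEN iffD2, OF eq s])
qed

text \<open>Cramer's rule for the linear system whose matrix is the Gram matrix of the partial derivatives.\<close>

lemma smooth_on_tangent_component:
  fixes F :: "real^'n::finite \<Rightarrow> 'b::euclidean_space" and Z :: "real^'n \<Rightarrow> real^'n"
  assumes U: "open U" and F: "smooth_on U F"
    and inj: "\<And>x u. x \<in> U \<Longrightarrow> dd F u x = 0 \<Longrightarrow> u = 0"
    and Z: "\<And>x w. x \<in> U \<Longrightarrow> dd F (Z x) x \<bullet> dd F w x = k x w"
    and k: "\<And>w. smooth_on U (\<lambda>x. k x w)"
  shows "smooth_on U Z"
proof -
  define A where "A x = (\<chi> i j. dd F (axis j 1) x \<bullet> dd F (axis i 1) x)" for x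
  define B where "B l x = (\<chi> i j. if j = l then k x (axis i 1) else A x $ i $ j)" for l x
  have expand: "dd F y x = (\<Sum>j\<in>UNIV. y $ j *\<^sub>R dd F (axis j 1) x)" if "x \<in> U" for x y
  proof -
    have "dd F y x = dd F (\<Sum>j\<in>UNIV. y $ j *\<^sub>R axis j 1) x"
      using basis_expansion[of y] by (simp add: scalar_mult_eq_scaleR)
    then show ?thesis
      using linear_dd_smooth[OF F that] by (simp add: linear_sum linear_cmul)
  qed
  have A: "(A x *v y) $ i = dd F y x \<bullet> dd F (axis i 1) x" if "x \<in> U" for x y i
    by (simp add: expand[OF that, of y] A_def matrix_vector_mult_def inner_sum_left mult.commute)
  have det: "det (A x) \<noteq> 0" if x: "x \<in> U" for x
  proof -
    have "y = 0" if "A x *v y = 0" for y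
    proof -
      have "dd F y x \<bullet> dd F y x = (\<Sum>i\<in>UNIV. y $ i * (dd F y x \<bullet> dd F (axis i 1) x))"
        by (subst (2) expand[OF x]) (simp add: inner_sum_right)
      also have "\<dots> = 0" using A[OF x, of y] that by simp
      finally show ?thesis using inj[OF x] by simp
    qed
    then show ?thesis
      using matrix_left_invertible_ker[of "A x"] invertible_left_inverse[of "A x"] invertible_det_nz by blast
  qed
  \<comment> \<open>The quotient is expanded by the determinant because
    \<open>smooth_on_inverse\<close> asks for a positive function, which the square is.\<close>
  have Z_eq: "Z x $ l = det (B l x) * det (A x) * inverse (det (A x) * det (A x))" if x: "x \<in> U" for x l
  proof -
    have "A x *v Z x = (\<chi> i. k x (axis i 1))" using A[OF x] Z[OF x] by (simp add: vec_eq_iff)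
    then have "Z x = (\<chi> l. det (\<chi> i j. if j = l then k x (axis i 1) else A x $ i $ j) / det (A x))"
      using cramer[OF det[OF x], of "Z x" "\<chi> i. k x (axis i 1)"] unfolding vec_lambda_beta by simp
    then show ?thesis using det[OF x] by (simp add: B_def field_simps)
  qed
  have sA: "smooth_on U (\<lambda>x. A x $ i $ j)" for i j
    by (simp add: A_def smooth_on_inner[OF U smooth_on_dd[OF F] smooth_on_dd[OF F]])
  have sB: "smooth_on U (\<lambda>x. B l x $ i $ j)" for l i j
    by (cases "j = l") (simp_all add: B_def k sA)
  have "smooth_on U (\<lambda>x. det (B l x) * det (A x) * inverse (det (A x) * det (A x)))" for l
    using det
    by (intro smooth_on_mult smooth_on_inverse smooth_on_det U sA sB)
      (auto simp: zero_less_mult_iff linorder_neq_iff)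
  then have "smooth_on U (\<lambda>x. Z x $ l)" for l
    using smooth_on_cong[OF U Z_eq] by simp
  then show ?thesis by (rule smooth_on_vec[OF U])
qed

text \<open>\<open>sharp\<close> is a definite description, so a unique representing vector must be
  exhibited. Definiteness makes the map from w to \<open>g w\<close> injective, hence surjective by
  dimension.\<close>

lemma sharp_eq:
  fixes g :: "'a::euclidean_space \<Rightarrow> 'a \<Rightarrow> real"
  assumes "bilinear g" "\<And>u. u \<noteq> 0 \<Longrightarrow> g u u > 0" "linear k"
  shows "g (sharp g k) u = k u"
proof -
  define T where "T w = (\<Sum>b\<in>Basis. g w b *\<^sub>R b)" for w
  have lin: "linear (g w)" "linear (\<lambda>w. g w u)" for w u using assms(1) by (auto simp: bilinear_def)
  have T: "linear T" unfolding T_def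
    using lin(2) by (intro linear_compose_sum ballI linear_compose_scale_right[unfolded o_def])
      (auto simp: linear_iff algebra_simps)
  have T_inner: "u \<bullet> T w = g w u" for u w
    using linear_sum_Basis[OF lin(1), of w u] by (simp add: T_def inner_sum_right mult.commute)
  have inj: "w = w'" if "\<And>u. g w u = g w' u" for w w'
  proof -
    have "g (w - w') (w - w') = 0" using that by (simp add: linear_diff[OF lin(2)])
    then show ?thesis using assms(2)[of "w - w'"] by auto
  qed
  have "inj T"
  proof (rule injI)
    fix w w' assume "T w = T w'"
    then have "g w u = g w' u" for u using T_inner[of u w] T_inner[of u w'] by simp
    then show "w = w'" by (rule inj)
  qed
  then have "surj T" using linear_injective_imp_surjective[OF T] by simp
  then obtain w where w: "T w = adjoint k 1" by (metis surjD)
  have "\<forall>u. g w u = k u"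
    using T_inner[of _ w] adjoint_works[OF assms(3), of _ 1] by (simp add: w)
  then have "\<exists>!w. \<forall>u. g w u = k u"
    by (rule ex1I) (simp add: inj \<open>\<forall>u. g w u = k u\<close>)
  from theI'[OF this] show ?thesis unfolding sharp_def ..
qed

section \<open>Connections induced by immersions\<close>

lemma bilinear_immersion:
  assumes "linear L"
  shows "bilinear (\<lambda>u v. L u \<bullet> L v)"
  unfolding bilinear_def using assms
  by (auto simp: linear_iff inner_add_left inner_add_right)

text \<open>For an induced metric the Koszul expression has six products of a second with a first
  derivative; by symmetry of the second derivatives, four cancel and two coincide. So the
  Christoffel vector is the tangential part of the second derivative.\<close>

lemma christoffel_immersion:
  fixes F :: "real^'n::finite \<Rightarrow> 'b::euclidean_space"
  assumes U: "open U" and F: "smooth_on U F" and x: "x \<in> U"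
    and inj: "\<And>u. dd F u x = 0 \<Longrightarrow> u = 0"
    and G: "\<And>z u v. z \<in> U \<Longrightarrow> G z u v = dd F u z \<bullet> dd F v z"
  shows "dd F (christoffel G x u v) x \<bullet> dd F w x = dd (dd F v) u x \<bullet> dd F w x"
proof -
  have dG: "dd (\<lambda>z. G z v w) u x = dd F v x \<bullet> dd (dd F w) u x + dd (dd F v) u x \<bullet> dd F w x" for u v w
    unfolding dd_inner[OF smooth_on_dd[OF F] smooth_on_dd[OF F] x, symmetric]
    by (rule fun_cong[OF dd_cong[OF U x G]])
  have "(\<lambda>w. (dd (\<lambda>z. G z v w) u x + dd (\<lambda>z. G z u w) v x - dd (\<lambda>z. G z u v) w x) / 2)
      = (\<lambda>w. dd (dd F v) u x \<bullet> dd F w x)"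
  proof (rule ext)
    fix w
    show "(dd (\<lambda>z. G z v w) u x + dd (\<lambda>z. G z u w) v x - dd (\<lambda>z. G z u v) w x) / 2
        = dd (dd F v) u x \<bullet> dd F w x"
      unfolding dG dd_symmetric[OF U F x, of u v] dd_symmetric[OF U F x, of u w] dd_symmetric[OF U F x, of v w]
      by (simp add: inner_commute)
  qed
  then have *: "christoffel G x u v = sharp (G x) (\<lambda>w. dd (dd F v) u x \<bullet> dd F w x)"
    by (simp add: christoffel_def)
  have Gx: "G x = (\<lambda>u v. dd F u x \<bullet> dd F v x)" using G[OF x] by blast
  note lin = linear_dd_smooth[OF F x]
  have "G x (sharp (G x) (\<lambda>w. dd (dd F v) u x \<bullet> dd F w x)) w = dd (dd F v) u x \<bullet> dd F w x"
  proof (rule sharp_eq[where g = "G x" and k = "\<lambda>w. dd (dd F v) u x \<bullet> dd F w x"])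
    show "bilinear (G x)" unfolding Gx by (rule bilinear_immersion[OF lin])
    show "G x u u > 0" if "u \<noteq> 0" for u using inj that by (auto simp: Gx)
    show "linear (\<lambda>w. dd (dd F v) u x \<bullet> dd F w x)"
      using lin by (auto simp: linear_iff inner_add_right)
  qed
  then show ?thesis by (simp add: * G[OF x])
qed

text \<open>The derivative of L is applied in a moving direction b at a moving point y, as happens
  when fields are pushed forward. The basis expansion again reduces to fixed directions.\<close>

lemma dd_apply_field:
  fixes y :: "'a::euclidean_space \<Rightarrow> 'b::euclidean_space" and L :: "'b \<Rightarrow> 'c::euclidean_space"
  assumes U: "open U" and T: "open T" and L: "smooth_on T L" and y: "smooth_on U y" and b: "smooth_on U b"
    and sub: "y ` U \<subseteq> T" and x: "x \<in> U"
  shows "dd (\<lambda>z. dd L (b z) (y z)) u x = dd L (dd b u x) (y x) + dd (dd L (b x)) (dd y u x) (y x)"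
    and "smooth_on U (\<lambda>z. dd L (b z) (y z))"
proof -
  have yx: "y z \<in> T" if "z \<in> U" for z using sub that by auto
  have expand: "dd L v z = (\<Sum>i\<in>Basis. (v \<bullet> i) *\<^sub>R dd L i z)" if "z \<in> T" for v z
    using linear_sum_Basis[OF linear_dd_smooth[OF L that]] .
  have sL: "smooth_on U (\<lambda>z. dd L i (y z))" for i
    by (rule smooth_on_compose[OF U y smooth_on_dd[OF L] sub])
  have sb: "smooth_on U (\<lambda>z. b z \<bullet> i)" for i
    by (rule smooth_on_inner[OF U b smooth_on_const])
  have s: "smooth_on U (\<lambda>z. \<Sum>i\<in>Basis. (b z \<bullet> i) *\<^sub>R dd L i (y z))"
    by (intro smooth_on_sum smooth_on_scaleR U sL sb) auto
  show "smooth_on U (\<lambda>z. dd L (b z) (y z))"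
    by (rule smooth_on_cong[OF U, THEN iffD2, OF expand[OF yx] s])
  have i: "((\<lambda>z. (b z \<bullet> i) *\<^sub>R dd L i (y z)) has_derivative
      (\<lambda>u. (b x \<bullet> i) *\<^sub>R dd (dd L i) (dd y u x) (y x) + (dd b u x \<bullet> i) *\<^sub>R dd L i (y x))) (at x)" for i
    using smooth_on_has_derivative[OF smooth_on_scaleR[OF U sb sL] x, of i i]
      dd_scaleR[OF sb sL x] dd_compose[OF y smooth_on_dd[OF L] x yx[OF x]]
      dd_inner[OF b smooth_on_const x] by simp
  have ii: "((\<lambda>z. (b x \<bullet> i) *\<^sub>R dd L i z) has_derivative (\<lambda>w. (b x \<bullet> i) *\<^sub>R dd (dd L i) w (y x))) (at (y x))" for i
    by (intro has_derivative_scaleR_right smooth_on_has_derivative[OF smooth_on_dd[OF L] yx[OF x]])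
  have "dd (\<lambda>z. dd L (b z) (y z)) u x = dd (\<lambda>z. \<Sum>i\<in>Basis. (b z \<bullet> i) *\<^sub>R dd L i (y z)) u x"
    by (rule fun_cong[OF dd_cong[OF U x expand[OF yx]]])
  also have "\<dots> = (\<Sum>i\<in>Basis. (b x \<bullet> i) *\<^sub>R dd (dd L i) (dd y u x) (y x) + (dd b u x \<bullet> i) *\<^sub>R dd L i (y x))"
    by (rule dd_eqI[OF has_derivative_sum[OF i]])
  also have "\<dots> = (\<Sum>i\<in>Basis. (dd b u x \<bullet> i) *\<^sub>R dd L i (y x)) + (\<Sum>i\<in>Basis. (b x \<bullet> i) *\<^sub>R dd (dd L i) (dd y u x) (y x))"
    by (simp add: sum.distrib add.commute)
  also have "(\<Sum>i\<in>Basis. (dd b u x \<bullet> i) *\<^sub>R dd L i (y x)) = dd L (dd b u x) (y x)"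
    by (rule expand[OF yx[OF x], symmetric])
  also have "(\<Sum>i\<in>Basis. (b x \<bullet> i) *\<^sub>R dd (dd L i) (dd y u x) (y x))
      = dd (\<lambda>z. \<Sum>i\<in>Basis. (b x \<bullet> i) *\<^sub>R dd L i z) (dd y u x) (y x)"
    by (rule dd_eqI[OF has_derivative_sum[OF ii], symmetric])
  also have "\<dots> = dd (dd L (b x)) (dd y u x) (y x)"
    by (rule fun_cong[OF dd_cong[OF T yx[OF x] expand], symmetric])
  finally show "dd (\<lambda>z. dd L (b z) (y z)) u x = dd L (dd b u x) (y x) + dd (dd L (b x)) (dd y u x) (y x)" .
qed

section \<open>The lift of projective space to the sphere\<close>

lemma rp_lift_eq: "rp_lift c y = (inverse (sqrt c) * (1 + y \<bullet> y) powr (- 1 / 2)) *\<^sub>R ((y, 0) + (0, 1))"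
proof -
  \<comment> \<open>The norm becomes a power of a positive polynomial, to which
    \<open>smooth_on_powr\<close> applies.\<close>
  have "norm (y, 1::real) = (1 + y \<bullet> y) powr (1 / 2)"
    by (simp add: norm_Pair power2_norm_eq_inner powr_half_sqrt add.commute)
  moreover have "(1 + y \<bullet> y) powr (- 1 / 2) = inverse ((1 + y \<bullet> y) powr (1 / 2))"
    using powr_minus[of "1 + y \<bullet> y" "1 / 2"] by simp
  ultimately show ?thesis by (simp add: rp_lift_def inverse_eq_divide)
qed

lemma rp_lift_scale_smooth:
  "smooth_on UNIV (\<lambda>y::real^'k::finite. inverse (sqrt c) * (1 + y \<bullet> y) powr (- 1 / 2))"
proof (intro smooth_on_mult smooth_on_const open_UNIV)
  show "smooth_on UNIV (\<lambda>y::real^'k. (1 + y \<bullet> y) powr (- 1 / 2))"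
  proof (rule smooth_on_compose[OF open_UNIV _ smooth_on_powr])
    show "smooth_on UNIV (\<lambda>y::real^'k. 1 + y \<bullet> y)"
      by (intro smooth_on_add smooth_on_inner smooth_on_const smooth_on_id open_UNIV)
    show "range (\<lambda>y::real^'k. 1 + y \<bullet> y) \<subseteq> {0<..}"
      by (auto simp: add_pos_nonneg)
  qed
qed

lemma smooth_pair_one: "smooth_on UNIV (\<lambda>y::real^'k::finite. (y, 0::real) + (0, 1))"
  by (intro smooth_on_add smooth_on_const open_UNIV
      smooth_on_bounded_linear[OF bounded_linear_Pair[OF bounded_linear_ident bounded_linear_zero] open_UNIV smooth_on_id])

lemma smooth_rp_lift: "smooth_on UNIV (rp_lift c :: real^'k::finite \<Rightarrow> _)"
  unfolding rp_lift_eq[abs_def]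
  by (rule smooth_on_scaleR[OF open_UNIV rp_lift_scale_smooth smooth_pair_one])

lemma rp_lift_inner:
  assumes "c > 0"
  shows "rp_lift c y \<bullet> rp_lift c y = 1 / c"
proof -
  have "norm (y, 1::real) \<noteq> 0" by (simp add: zero_prod_def)
  moreover have "norm (rp_lift c y) = \<bar>1 / (sqrt c * norm (y, 1::real))\<bar> * norm (y, 1::real)"
    by (simp only: rp_lift_def norm_scaleR)
  ultimately have "norm (rp_lift c y) = 1 / sqrt c" using assms by simp
  then have "(norm (rp_lift c y))\<^sup>2 = 1 / c" using assms by (simp add: power_divide)
  then show ?thesis by (simp add: power2_norm_eq_inner)
qed

text \<open>The last coordinate of the lift is the scale factor s itself, so its derivative along u
  vanishes; the other coordinates then give s u = 0.\<close>

lemma rp_lift_immersion: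
  fixes y :: "real^'k::finite"
  assumes c: "c > 0" and u: "dd (rp_lift c) u y = 0"
  shows "u = 0"
proof -
  define s where "s y = inverse (sqrt c) * (1 + y \<bullet> y) powr (- 1 / 2)" for y :: "real^'k"
  have smooth_s: "smooth_on UNIV s" unfolding s_def[abs_def] by (rule rp_lift_scale_smooth)
  have "1 + y \<bullet> y > 0" by (simp add: add_pos_nonneg)
  then have pos: "s y > 0" using c by (auto simp: s_def)
  have "((\<lambda>y::real^'k. (y, 0::real) + (0, 1)) has_derivative (\<lambda>u. (u, 0))) (at y)"
    by (auto intro!: derivative_eq_intros)
  then have d: "dd (\<lambda>y::real^'k. (y, 0::real) + (0, 1)) u y = (u, 0)" by (rule dd_eqI)
  have "dd (rp_lift c) u y = dd (\<lambda>y. s y *\<^sub>R ((y, 0) + (0, 1))) u y"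
    unfolding rp_lift_eq[abs_def] s_def ..
  also have "\<dots> = s y *\<^sub>R (u, 0) + dd s u y *\<^sub>R ((y, 0) + (0, 1))"
    unfolding d[symmetric]
    by (rule dd_scaleR[OF smooth_s smooth_pair_one UNIV_I])
  finally have "s y *\<^sub>R u + dd s u y *\<^sub>R y = 0" "dd s u y = 0"
    using u by (auto simp: prod_eq_iff)
  then show ?thesis using pos by simp
qed

section \<open>Topology and affine charts of projective space\<close>

lemma openin_rp_topology:
  fixes W :: "((real^'k::finite) \<times> real) set set"
  shows "openin (rp_topology c) W \<longleftrightarrow> W \<subseteq> rp_points c \<and>
     openin (top_of_set (sphere 0 (1 / sqrt c))) {x \<in> sphere 0 (1 / sqrt c). {x, - x} \<in> W}"
proof -
  let ?S = "sphere 0 (1 / sqrt c) :: ((real^'k) \<times> real) set"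
  let ?P = "\<lambda>W :: ((real^'k) \<times> real) set set. W \<subseteq> rp_points c \<and> openin (top_of_set ?S) {x \<in> ?S. {x, - x} \<in> W}"
  have "istopology ?P"
    unfolding istopology_def
  proof (intro conjI allI impI)
    fix S T assume S: "?P S" and T: "?P T"
    show "S \<inter> T \<subseteq> rp_points c" by (rule le_infI1[OF conjunct1[OF S]])
    have eq: "{x \<in> ?S. {x, - x} \<in> S \<inter> T} = {x \<in> ?S. {x, - x} \<in> S} \<inter> {x \<in> ?S. {x, - x} \<in> T}"
      by blast
    show "openin (top_of_set ?S) {x \<in> ?S. {x, - x} \<in> S \<inter> T}"
      unfolding eq by (rule openin_Int[OF conjunct2[OF S] conjunct2[OF T]])
  next
    fix K assume K: "\<forall>W\<in>K. ?P W"
    then show "\<Union>K \<subseteq> rp_points c" by (intro Union_least) simp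
    have eq: "{x \<in> ?S. {x, - x} \<in> \<Union>K} = \<Union>((\<lambda>W. {x \<in> ?S. {x, - x} \<in> W}) ` K)" by blast
    show "openin (top_of_set ?S) {x \<in> ?S. {x, - x} \<in> \<Union>K}"
      unfolding eq by (rule openin_Union) (use K in blast)
  qed
  then show ?thesis by (simp add: rp_topology_def topology_inverse')
qed

lemma topspace_rp_topology: "topspace (rp_topology c) = rp_points c"
proof
  have eq: "{x \<in> sphere 0 (1 / sqrt c). {x, - x} \<in> rp_points c} = sphere 0 (1 / sqrt c)"
    unfolding rp_points_def by blast
  have "openin (rp_topology c) (rp_points c)"
    unfolding openin_rp_topology eq by (intro conjI order_refl openin_subtopology_self)
  then show "rp_points c \<subseteq> topspace (rp_topology c)" by (rule openin_subset)
  show "topspace (rp_topology c) \<subseteq> rp_points c"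
    using openin_topspace openin_rp_topology by blast
qed

lemma openin_rp_chart:
  assumes "orthogonal_transformation A"
  shows "openin (rp_topology c) (fst (rp_chart c A))"
proof -
  let ?S = "sphere 0 (1 / sqrt c) :: ((real^'k) \<times> real) set"
  have lin: "linear A" using assms orthogonal_transformation_linear by blast
  have "{x \<in> ?S. {x, - x} \<in> fst (rp_chart c A)} = ?S \<inter> {x. snd (A x) \<noteq> 0}"
    by (auto simp: rp_chart_def rp_points_def linear_neg[OF lin])
  moreover have "open {x. snd (A x) \<noteq> 0}"
    by (intro open_Collect_neq continuous_on_snd linear_continuous_on linear_linear[THEN iffD2] lin
        continuous_on_const)
  ultimately show ?thesis
    unfolding openin_rp_topology by (auto simp: rp_chart_def openin_open)
qed

lemma rp_chart_covers:
  fixes P :: "((real^'k::finite) \<times> real) set"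
  assumes "c > 0" "P \<in> rp_points c"
  obtains A where "orthogonal_transformation A" "P \<in> fst (rp_chart c A)"
proof -
  obtain x where x: "P = {x, - x}" "norm x = 1 / sqrt c" using assms(2) by (auto simp: rp_points_def)
  obtain A :: "(real^'k) \<times> real \<Rightarrow> (real^'k) \<times> real"
    where A: "orthogonal_transformation A" "snd (A x) \<noteq> 0"
  proof (cases "snd x = 0")
    case False
    then show thesis using that[of "\<lambda>x. x"] orthogonal_transformation_id by simp
  next
    case True
    \<comment> \<open>R is the reflection in the hyperplane orthogonal to w; it exchanges x and the
      multiple of (0, 1) of equal length, and so moves x off the hyperplane at infinity.\<close>
    define w where "w = x - norm x *\<^sub>R (0, 1)"
    define R where "R y = y - (2 * (y \<bullet> w) / (w \<bullet> w)) *\<^sub>R w" for y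
    have nx: "norm x > 0" using x(2) assms(1) by simp
    have xx: "x \<bullet> x = norm x * norm x" by (simp add: dot_square_norm power2_eq_square)
    have xe: "x \<bullet> (0, t) = 0" for t using True by (simp add: inner_Pair_0)
    have ww: "w \<bullet> w = 2 * (norm x * norm x)" "x \<bullet> w = norm x * norm x"
      using xx xe by (simp_all add: w_def inner_expand inner_commute)
    have "R x = norm x *\<^sub>R (0, 1)" using ww nx by (simp add: R_def w_def)
    moreover have "orthogonal_transformation R"
      unfolding orthogonal_transformation_def
    proof (intro conjI allI)
      show "linear R" unfolding R_def
        by (intro linearI) (auto simp: inner_expand algebra_simps add_divide_distrib)
      show "R v \<bullet> R u = v \<bullet> u" for v u
        using ww nx by (simp add: R_def inner_expand inner_commute field_simps)
    qed
    ultimately show thesis using that[of R] nx by simp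
  qed
  have "linear A" using A(1) orthogonal_transformation_linear by blast
  then have "P \<in> fst (rp_chart c A)"
    using A(2) assms(2) by (auto simp: rp_chart_def x(1) linear_neg)
  then show thesis using that A(1) by blast
qed

lemma rp_chart_param:
  assumes c: "c > 0" and A: "orthogonal_transformation A"
  shows "snd (rp_chart c A) (param (rp_chart c A) y) = y"
proof -
  have lin: "linear A" using A orthogonal_transformation_linear by blast
  obtain x where x: "A x = rp_lift c y"
    using orthogonal_transformation_surj[OF A] by (metis surjD)
  have "norm (rp_lift c y) = 1 / sqrt c"
    using rp_lift_inner[OF c, of y] c by (simp add: norm_eq_sqrt_inner real_sqrt_divide)
  then have nx: "norm x = 1 / sqrt c" using orthogonal_transformation_norm[OF A, of x] x by simp
  have "norm (y, 1::real) \<noteq> 0" by (simp add: zero_prod_def)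
  then have s: "snd (A x) \<noteq> 0" "fst (A x) /\<^sub>R snd (A x) = y"
    using c by (auto simp: x rp_lift_def)
  have "{x, - x} \<in> rp_points c" using nx by (auto simp: rp_points_def)
  then have P: "{x, - x} \<in> fst (rp_chart c A)" using s by (auto simp: rp_chart_def linear_neg[OF lin])
  \<comment> \<open>The quotient in the chart is the same for x and - x, so the choice of
    representative is immaterial.\<close>
  have "(SOME z. z \<in> {x, - x}) \<in> {x, - x}" by (rule someI) auto
  then have "snd (rp_chart c A) {x, - x} = y"
    using s by (auto simp: rp_chart_def linear_neg[OF lin])
  then have "y \<in> snd (rp_chart c A) ` fst (rp_chart c A)" using P by blast
  then show ?thesis unfolding param_def by (rule f_inv_into_f)
qed

lemma local_metric_rp_space:
  assumes "c > 0" "d \<in> atlas_of (rp_space c)"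
  shows "local_metric (rp_space c) d z u v = dd (rp_lift c) u z \<bullet> dd (rp_lift c) v z"
proof -
  obtain A where A: "orthogonal_transformation A" "d = rp_chart c A"
    using assms(2) unfolding rp_space_def rmfd.simps by blast
  show ?thesis
    unfolding local_metric_def rp_space_def rmfd.simps A(2) rp_chart_param[OF assms(1) A(1)] ..
qed

section \<open>Restriction and reversal of patches\<close>

lemma quasi_umbilical_patch_subset:
  assumes "quasi_umbilical_patch U F N c \<alpha> \<beta> \<eta> \<xi>" "open W" "W \<subseteq> U"
  shows "quasi_umbilical_patch W F N c \<alpha> \<beta> \<eta> \<xi>"
proof -
  interpret quasi_umbilical_patch U F N c \<alpha> \<beta> \<eta> \<xi> by fact
  have sub: "x \<in> U" if "x \<in> W" for x using assms(3) that by blast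
  note s = smooth_on_subset[OF _ assms(3)]
  show ?thesis
    by unfold_locales
      (fact assms(2) c_pos codim dim_gt_2 s[OF smooth_F] s[OF smooth_N] s[OF smooth_\<alpha>] s[OF smooth_\<beta>]
          s[OF smooth_\<eta>] F_F[OF sub] N_N[OF sub] N_F[OF sub] N_dF[OF sub] dF_inj[OF sub]
          linear_add[OF linear_\<eta>[OF sub]] linear_cmul[OF linear_\<eta>[OF sub]] dF_\<xi>[OF sub] \<eta>_\<xi>[OF sub] second_form_eq[OF sub])+
qed

lemma quasi_umbilical_patch_uminus:
  assumes "quasi_umbilical_patch U F N c \<alpha> \<beta> \<eta> \<xi>"
  shows "quasi_umbilical_patch U F (\<lambda>x. - N x) c (\<lambda>x. - \<alpha> x) (\<lambda>x. - \<beta> x) \<eta> \<xi>"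
proof -
  interpret quasi_umbilical_patch U F N c \<alpha> \<beta> \<eta> \<xi> by fact
  show ?thesis
    by unfold_locales
      (fact open_U smooth_F c_pos codim dim_gt_2 F_F dF_inj smooth_\<eta> dF_\<xi> \<eta>_\<xi>
          linear_add[OF linear_\<eta>] linear_cmul[OF linear_\<eta>] smooth_on_uminus[OF open_U smooth_N] smooth_on_uminus[OF open_U smooth_\<alpha>]
          smooth_on_uminus[OF open_U smooth_\<beta>]
        | simp add: N_N N_F N_dF second_form_eq)+
qed

section \<open>The Ricci curvature in the direction of the dual field\<close>

lemma christoffel_patch:
  fixes F :: "real^'n::finite \<Rightarrow> 'b::euclidean_space"
  assumes patch: "spherical_patch U F N c" and x: "x \<in> U"
    and G: "\<And>z u v. z \<in> U \<Longrightarrow> G z u v = dd F u z \<bullet> dd F v z"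
  shows "dd F (christoffel G x u v) x \<bullet> dd F w x = dd (dd F v) u x \<bullet> dd F w x"
proof -
  interpret spherical_patch U F N c by fact
  show ?thesis by (rule christoffel_immersion[OF open_U smooth_F x dF_inj[OF x] G])
qed

lemma smooth_on_christoffel:
  fixes F :: "real^'n::finite \<Rightarrow> 'b::euclidean_space"
  assumes patch: "spherical_patch U F N c"
    and G: "\<And>z u v. z \<in> U \<Longrightarrow> G z u v = dd F u z \<bullet> dd F v z"
  shows "smooth_on U (\<lambda>z. christoffel G z u v)"
proof -
  interpret spherical_patch U F N c by fact
  show ?thesis
    by (rule smooth_on_tangent_component[OF open_U smooth_F dF_inj christoffel_patch[OF patch _ G]])
      (auto intro!: smooth_on_inner smooth_on_dd open_U smooth_F)
qed

lemma gauss_formula: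
  fixes F :: "real^'n::finite \<Rightarrow> 'b::euclidean_space"
  assumes patch: "spherical_patch U F N c" and x: "x \<in> U"
    and G: "\<And>z u v. z \<in> U \<Longrightarrow> G z u v = dd F u z \<bullet> dd F v z"
  shows "dd (dd F v) u x = dd F (christoffel G x u v) x + (dd (dd F v) u x \<bullet> N x) *\<^sub>R N x
    - (c * (dd F u x \<bullet> dd F v x)) *\<^sub>R F x"
proof -
  interpret spherical_patch U F N c by fact
  have "dd (dd F v) u x - dd F (christoffel G x u v) x - (dd (dd F v) u x \<bullet> N x) *\<^sub>R N x
      + (c * (dd F u x \<bullet> dd F v x)) *\<^sub>R F x = 0"
  proof (rule eq_0_if_orthogonal[OF x])
    show "(dd (dd F v) u x - dd F (christoffel G x u v) x - (dd (dd F v) u x \<bullet> N x) *\<^sub>R N x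
      + (c * (dd F u x \<bullet> dd F v x)) *\<^sub>R F x) \<bullet> F x = 0"
      using ddF_F[OF x] F_dF[OF x] N_F[OF x] F_F[OF x] c_pos
      by (simp add: inner_expand) (simp add: inner_commute)
    show "(dd (dd F v) u x - dd F (christoffel G x u v) x - (dd (dd F v) u x \<bullet> N x) *\<^sub>R N x
      + (c * (dd F u x \<bullet> dd F v x)) *\<^sub>R F x) \<bullet> N x = 0"
      using N_dF[OF x] N_F[OF x] N_N[OF x] by (simp add: inner_expand) (simp add: inner_commute)
    show "(dd (dd F v) u x - dd F (christoffel G x u v) x - (dd (dd F v) u x \<bullet> N x) *\<^sub>R N x
      + (c * (dd F u x \<bullet> dd F v x)) *\<^sub>R F x) \<bullet> dd F w x = 0" for w
      using N_dF[OF x] F_dF[OF x] christoffel_patch[OF patch x G] by (simp add: inner_expand)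
  qed
  then show ?thesis by (simp add: algebra_simps)
qed

text \<open>The Gauss formula is differentiated once more and projected to the tangent space.
  Antisymmetrised in w and u, the third derivatives disappear and the Gauss equation
  results.\<close>

lemma gauss_derivative:
  fixes F :: "real^'n::finite \<Rightarrow> 'b::euclidean_space"
  assumes patch: "spherical_patch U F N c" and x: "x \<in> U"
    and G: "\<And>z u v. z \<in> U \<Longrightarrow> G z u v = dd F u z \<bullet> dd F v z"
  shows "dd F (dd (\<lambda>z. christoffel G z u v) w x + christoffel G x w (christoffel G x u v)) x \<bullet> dd F y x
    = dd (dd (dd F v) u) w x \<bullet> dd F y x
      + (dd (dd F v) u x \<bullet> N x) * (dd (dd F y) w x \<bullet> N x)
      + c * (dd F u x \<bullet> dd F v x) * (dd F w x \<bullet> dd F y x)"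
proof -
  interpret spherical_patch U F N c by fact
  define h where "h z = dd (dd F v) u z \<bullet> N z" for z
  define k where "k z = c * (dd F u z \<bullet> dd F v z)" for z
  define \<Gamma> where "\<Gamma> z = christoffel G z u v" for z
  have \<Gamma>: "smooth_on U \<Gamma>" unfolding \<Gamma>_def by (rule smooth_on_christoffel[OF patch G])
  have h: "smooth_on U h" unfolding h_def by (intro smooth_on_inner smooth_on_dd open_U smooth_F smooth_N)
  have k: "smooth_on U k" unfolding k_def
    by (intro smooth_on_mult smooth_on_const smooth_on_inner smooth_on_dd open_U smooth_F)
  note a = dd_apply_field[OF open_U open_U smooth_F smooth_on_id \<Gamma> _ x, simplified]
  have s1: "smooth_on U (\<lambda>z. dd F (\<Gamma> z) z)" using a(2) .
  have s2: "smooth_on U (\<lambda>z. h z *\<^sub>R N z)" by (rule smooth_on_scaleR[OF open_U h smooth_N])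
  have s3: "smooth_on U (\<lambda>z. k z *\<^sub>R F z)" by (rule smooth_on_scaleR[OF open_U k smooth_F])
  have gf: "dd (dd F v) u z = dd F (\<Gamma> z) z + h z *\<^sub>R N z - k z *\<^sub>R F z" if "z \<in> U" for z
    unfolding \<Gamma>_def h_def k_def by (rule gauss_formula[OF patch that G])
  have "dd (dd (dd F v) u) w x = dd (\<lambda>z. dd F (\<Gamma> z) z + h z *\<^sub>R N z - k z *\<^sub>R F z) w x"
    by (rule fun_cong[OF dd_cong[OF open_U x gf]])
  also have "\<dots> = dd (\<lambda>z. dd F (\<Gamma> z) z) w x + dd (\<lambda>z. h z *\<^sub>R N z) w x - dd (\<lambda>z. k z *\<^sub>R F z) w x"
    unfolding dd_add[OF s1 s2 x, symmetric] by (rule dd_diff[OF smooth_on_add[OF open_U s1 s2] s3 x])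
  also have "\<dots> = (dd F (dd \<Gamma> w x) x + dd (dd F (\<Gamma> x)) w x) + (h x *\<^sub>R dd N w x + dd h w x *\<^sub>R N x)
      - (k x *\<^sub>R dd F w x + dd k w x *\<^sub>R F x)"
    unfolding dd_scaleR[OF h smooth_N x] dd_scaleR[OF k smooth_F x] a(1) ..
  finally have "dd (dd (dd F v) u) w x \<bullet> dd F y x = dd F (dd \<Gamma> w x) x \<bullet> dd F y x
      + dd (dd F (\<Gamma> x)) w x \<bullet> dd F y x - h x * (dd (dd F y) w x \<bullet> N x) - k x * (dd F w x \<bullet> dd F y x)"
    using dN_dF[OF x, of w y] N_dF[OF x, of y] F_dF[OF x, of y] by (simp add: inner_expand)
  moreover have "dd (dd F (\<Gamma> x)) w x \<bullet> dd F y x = dd F (christoffel G x w (\<Gamma> x)) x \<bullet> dd F y x"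
    by (rule christoffel_patch[OF patch x G, symmetric])
  ultimately show ?thesis
    unfolding linear_add[OF linear_dd_smooth[OF smooth_F x]] inner_add_left
    by (simp add: \<Gamma>_def[abs_def] h_def k_def)
qed

text \<open>The bracket of constant fields is zero; that \<open>christoffel\<close> vanishes in the
  direction 0 depends on the metric and is therefore assumed.\<close>

lemma curvature_const:
  assumes "christoffel G x 0 v = 0"
  shows "curvature G (\<lambda>_. w) (\<lambda>_. u) (\<lambda>_. v) x
    = (dd (\<lambda>z. christoffel G z u v) w x + christoffel G x w (christoffel G x u v))
      - (dd (\<lambda>z. christoffel G z w v) u x + christoffel G x u (christoffel G x w v))"
  using assms by (simp add: curvature_def levi_civita_def[abs_def] lie_bracket_def)

text \<open>By the Gauss equation, the operator taking w to R(w, xi) xi is K times the orthogonal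
  projection to ker eta, which has rank n - 1.\<close>

lemma ricci_dual_field:
  fixes F :: "real^'n::finite \<Rightarrow> 'b::euclidean_space"
  assumes patch: "quasi_umbilical_patch U F N c \<alpha> \<beta> \<eta> \<xi>" and x: "x \<in> U"
    and G: "\<And>z u v. z \<in> U \<Longrightarrow> G z u v = dd F u z \<bullet> dd F v z"
  shows "ricci G (\<lambda>_. \<xi> x) (\<lambda>_. \<xi> x) x = (c + \<alpha> x * (\<alpha> x + \<beta> x)) * (real CARD('n) - 1)"
proof -
  interpret quasi_umbilical_patch U F N c \<alpha> \<beta> \<eta> \<xi> by fact
  note sp = spherical_patch_axioms
  note lin = linear_dd_smooth[OF smooth_F x]
  define K where "K = c + \<alpha> x * (\<alpha> x + \<beta> x)"
  have inj: "u = v" if "\<And>y. dd F u x \<bullet> dd F y x = dd F v x \<bullet> dd F y x" for u v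
  proof -
    have "dd F (u - v) x \<bullet> dd F (u - v) x = 0"
      using that[of "u - v"] by (simp add: linear_diff[OF lin] inner_diff_left)
    then show ?thesis using dF_inj[OF x, of "u - v"] by simp
  qed
  have "dd (dd F v) 0 x = 0" for v
    by (rule linear_0[OF linear_dd_smooth[OF smooth_on_dd[OF smooth_F] x]])
  then have \<Gamma>0: "christoffel G x 0 v = 0" for v
    using inj[of "christoffel G x 0 v" 0] christoffel_patch[OF sp x G] linear_0[OF lin] by simp
  have \<eta>F: "dd F u x \<bullet> dd F (\<xi> x) x = \<eta> x u" for u using dF_\<xi>[OF x, of u] by (simp add: inner_commute)
  have R: "curvature G (\<lambda>_. w) (\<lambda>_. \<xi> x) (\<lambda>_. \<xi> x) x = K *\<^sub>R (w - \<eta> x w *\<^sub>R \<xi> x)" for w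
  proof (rule inj)
    fix y
    have d: "dd (dd (dd F (\<xi> x)) (\<xi> x)) w x = dd (dd (dd F (\<xi> x)) w) (\<xi> x) x"
      by (rule dd_symmetric[OF open_U smooth_on_dd[OF smooth_F] x])
    note g = gauss_derivative[OF sp x G, of "\<xi> x" "\<xi> x" w y] gauss_derivative[OF sp x G, of w "\<xi> x" "\<xi> x" y]
    show "dd F (curvature G (\<lambda>_. w) (\<lambda>_. \<xi> x) (\<lambda>_. \<xi> x) x) x \<bullet> dd F y x
        = dd F (K *\<^sub>R (w - \<eta> x w *\<^sub>R \<xi> x)) x \<bullet> dd F y x"
      unfolding curvature_const[OF \<Gamma>0]
      unfolding linear_diff[OF lin] linear_cmul[OF lin]
      unfolding inner_diff_left inner_scaleR_left
      by (simp only: g d second_form_eq[OF x] dF_\<xi>[OF x] \<eta>F \<eta>_\<xi>[OF x] K_def)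
        (simp add: algebra_simps)
  qed
  \<comment> \<open>The trace of the projection is n minus this sum.\<close>
  have "\<eta> x (\<xi> x) = (\<Sum>i\<in>UNIV. \<xi> x $ i * \<eta> x (axis i 1))"
    using linear_sum[OF linear_\<eta>[OF x], of "\<lambda>i. \<xi> x $ i *\<^sub>R axis i 1" UNIV] basis_expansion[of "\<xi> x"]
    by (simp add: scalar_mult_eq_scaleR linear_cmul[OF linear_\<eta>[OF x]])
  then have "(\<Sum>i\<in>UNIV. K * (1 - \<eta> x (axis i 1) * \<xi> x $ i)) = K * (real CARD('n) - 1)"
    using \<eta>_\<xi>[OF x] by (simp add: sum_subtractf mult.commute flip: sum_distrib_left)
  then show ?thesis
    by (simp add: ricci_def trace_def matrix_def R K_def axis_def)
qed

text \<open>With \<open>V x\<close> extended constantly, the bracket with V is minus the derivative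
  of V along itself. Differentiating the constant length of V along V shows that the bracket terms
  cancel the derivative of the metric.\<close>

lemma lie_derivative_unit_field:
  fixes F :: "real^'n::finite \<Rightarrow> 'b::euclidean_space"
  assumes U: "open U" and F: "smooth_on U F" and V: "smooth_on U V" and x: "x \<in> U"
    and G: "\<And>z u v. z \<in> U \<Longrightarrow> G z u v = dd F u z \<bullet> dd F v z"
    and unit: "\<And>z. z \<in> U \<Longrightarrow> G z (V z) (V z) = 1"
  shows "lie_derivative V G (\<lambda>_. V x) (\<lambda>_. V x) x = 0"
proof -
  note a = dd_apply_field[OF U U F smooth_on_id V _ x, simplified]
  have "dd F (V x) x \<bullet> dd (\<lambda>z. dd F (V z) z) (V x) x + dd (\<lambda>z. dd F (V z) z) (V x) x \<bullet> dd F (V x) x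
      = dd (\<lambda>z. dd F (V z) z \<bullet> dd F (V z) z) (V x) x"
    by (rule dd_inner[OF a(2) a(2) x, symmetric])
  also have "\<dots> = dd (\<lambda>_. 1) (V x) x"
    by (rule fun_cong[OF dd_cong[OF U x]]) (simp add: G[symmetric] unit)
  finally have "dd F (V x) x \<bullet> (dd F (dd V (V x) x) x + dd (dd F (V x)) (V x) x) = 0"
    unfolding a(1) by (simp add: inner_commute)
  moreover have "dd (\<lambda>z. G z (V x) (V x)) (V x) x = 2 * (dd F (V x) x \<bullet> dd (dd F (V x)) (V x) x)"
  proof -
    have "dd (\<lambda>z. G z (V x) (V x)) (V x) x = dd (\<lambda>z. dd F (V x) z \<bullet> dd F (V x) z) (V x) x"
      by (rule fun_cong[OF dd_cong[OF U x G]])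
    then show ?thesis
      unfolding dd_inner[OF smooth_on_dd[OF F] smooth_on_dd[OF F] x] by (simp add: inner_commute)
  qed
  moreover have "dd F (- dd V (V x) x) x = - dd F (dd V (V x) x) x"
    by (rule linear_neg[OF linear_dd_smooth[OF F x]])
  ultimately show ?thesis
    by (simp add: lie_derivative_def lie_bracket_def G[OF x] inner_expand inner_commute)
qed

section \<open>Charts of a manifold\<close>

lemma chart_homeomorphic:
  assumes "is_chart X k"
  shows "homeomorphic_map (subtopology X (fst k)) (top_of_set (chart_image k)) (snd k)"
    "openin X (fst k)" "open (chart_image k)" "topspace (subtopology X (fst k)) = fst k"
  using assms openin_subset by (fastforce simp: is_chart_def)+

lemma open_chart_image:
  assumes k: "is_chart X k" and W: "openin X W" "W \<subseteq> fst k"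
  shows "open (snd k ` W)"
proof -
  have "openin (subtopology X (fst k)) W"
    using W openin_open_subtopology[OF chart_homeomorphic(2)[OF k]] by simp
  then have "openin (top_of_set (chart_image k)) (snd k ` W)"
    using homeomorphic_imp_open_map[OF chart_homeomorphic(1)[OF k]] by (simp add: open_map_def)
  then show ?thesis using openin_open_eq[OF chart_homeomorphic(3)[OF k]] by simp
qed

lemma openin_chart_preimage:
  assumes k: "is_chart X k" and W: "open W"
  shows "openin X {q \<in> fst k. snd k q \<in> W}"
proof -
  have "openin (top_of_set (chart_image k)) (chart_image k \<inter> W)" using W by (simp add: openin_open_Int)
  from openin_continuous_map_preimage[OF homeomorphic_imp_continuous_map[OF chart_homeomorphic(1)[OF k]] this]
  have "openin (subtopology X (fst k)) {q \<in> fst k. snd k q \<in> chart_image k \<inter> W}"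
    unfolding chart_homeomorphic(4)[OF k] .
  moreover have "{q \<in> fst k. snd k q \<in> chart_image k \<inter> W} = {q \<in> fst k. snd k q \<in> W}"
    by (auto simp: chart_image_def)
  ultimately show ?thesis
    using openin_open_subtopology[OF chart_homeomorphic(2)[OF k]] by simp
qed

lemma param_chart: "is_chart X k \<Longrightarrow> q \<in> fst k \<Longrightarrow> param k (snd k q) = q"
  using homeomorphic_imp_injective_map[OF chart_homeomorphic(1)] chart_homeomorphic(4)
  unfolding param_def by (metis inv_into_f_f)

lemma chart_param:
  assumes "z \<in> chart_image k"
  shows "param k z \<in> fst k" "snd k (param k z) = z"
  using assms inv_into_into[of z "snd k" "fst k"] f_inv_into_f[of z "snd k" "fst k"]
  unfolding chart_image_def param_def by auto

lemma manifold_charts: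
  assumes "smooth_manifold M"
  shows "k \<in> atlas_of M \<Longrightarrow> is_chart (top_of M) k"
    and "p \<in> topspace (top_of M) \<Longrightarrow> \<exists>k\<in>atlas_of M. p \<in> fst k"
  using assms unfolding smooth_manifold_def smooth_atlas_def by blast+

lemma continuous_map_smooth_function:
  assumes M: "smooth_manifold M" and \<phi>: "smooth_function M \<phi>"
  shows "continuous_map (top_of M) euclideanreal \<phi>"
  unfolding continuous_map
proof (intro conjI allI impI)
  fix W :: "real set" assume "openin euclideanreal W"
  then have W: "open W" by simp
  show "openin (top_of M) {p \<in> topspace (top_of M). \<phi> p \<in> W}"
  proof (subst openin_subopen, intro ballI)
    fix p assume p: "p \<in> {p \<in> topspace (top_of M). \<phi> p \<in> W}"
    then obtain k where k: "k \<in> atlas_of M" "p \<in> fst k"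
      using manifold_charts(2)[OF M] by blast
    then have ch: "is_chart (top_of M) k" using manifold_charts(1)[OF M] by blast
    have "continuous_on (chart_image k) (\<phi> \<circ> param k)"
      using \<phi> k(1) smooth_on_continuous unfolding smooth_function_def by blast
    then have "open (chart_image k \<inter> (\<phi> \<circ> param k) -` W)"
      using continuous_open_preimage[OF _ chart_homeomorphic(3)[OF ch] W] by blast
    from openin_chart_preimage[OF ch this]
    have "openin (top_of M) {q \<in> fst k. snd k q \<in> chart_image k \<inter> (\<phi> \<circ> param k) -` W}" .
    moreover have "{q \<in> fst k. snd k q \<in> chart_image k \<inter> (\<phi> \<circ> param k) -` W} = {q \<in> fst k. \<phi> q \<in> W}"
      by (auto simp: param_chart[OF ch]) (simp add: chart_image_def)
    moreover have "fst k \<subseteq> topspace (top_of M)"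
      by (rule openin_subset[OF chart_homeomorphic(2)[OF ch]])
    ultimately show "\<exists>T. openin (top_of M) T \<and> p \<in> T \<and> T \<subseteq> {p \<in> topspace (top_of M). \<phi> p \<in> W}"
      using p k(2) by (intro exI[of _ "{q \<in> fst k. \<phi> q \<in> W}"]) auto
  qed
qed auto

text \<open>The bridge from tensor components in charts to the ambient computation: near p, the map
  f is followed by an affine chart of projective space and by \<open>rp_lift\<close>, and the normal
  is pushed forward along with it.\<close>

lemma hypersurface_patch:
  fixes M :: "('m, 'n::finite) rmfd" and f :: "'m \<Rightarrow> ((real^'k::finite) \<times> real) set"
  assumes n: "CARD('n) > 2" and c: "c > 0" and hs: "hypersurface M (rp_space c) f"
    and nu: "unit_normal_field M (rp_space c) f \<nu>"
    and qu: "quasi_umbilical M (rp_space c) f \<nu> \<alpha> \<beta> \<eta>" and p: "p \<in> topspace (top_of M)"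
  obtains k U and F N :: "real^'n \<Rightarrow> (real^'k) \<times> real"
  where "k \<in> atlas_of M" "p \<in> fst k" "open U" "snd k p \<in> U" "U \<subseteq> chart_image k"
    "quasi_umbilical_patch U F N c (\<lambda>z. \<alpha> (param k z)) (\<lambda>z. \<beta> (param k z)) (\<lambda>z. \<eta> k (param k z))
      (\<lambda>z. dual_field M \<eta> k (param k z))"
    "\<And>z u v. z \<in> U \<Longrightarrow> metric_of M k (param k z) u v = dd F u z \<bullet> dd F v z"
proof -
  let ?N = "rp_space c :: (((real^'k) \<times> real) set, 'k) rmfd"
  let ?L = "rp_lift c :: real^'k \<Rightarrow> (real^'k) \<times> real"
  have rm: "riemannian_manifold M" and sm: "smooth_map M ?N f" using hs by (simp_all add: hypersurface_def)
  have M: "smooth_manifold M" using rm by (simp add: riemannian_manifold_def)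
  obtain k where k: "k \<in> atlas_of M" "p \<in> fst k" using manifold_charts(2)[OF M p] by blast
  note ch = manifold_charts(1)[OF M k(1)]
  have top_N: "top_of ?N = rp_topology c" by (simp add: rp_space_def)
  have cont: "continuous_map (top_of M) (rp_topology c) f" using sm by (simp add: smooth_map_def top_N)
  then have "f p \<in> rp_points c"
    using p by (metis continuous_map_image_subset_topspace image_subset_iff topspace_rp_topology)
  then obtain A :: "(real^'k) \<times> real \<Rightarrow> (real^'k) \<times> real"
    where A: "orthogonal_transformation A" "f p \<in> fst (rp_chart c A)" using rp_chart_covers[OF c] by blast
  define d where "d = rp_chart c A"
  have d: "d \<in> atlas_of ?N" using A(1) by (auto simp: d_def rp_space_def)
  define S where "S = fst k \<inter> f -` fst d"
  define U where "U = snd k ` S"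
  define y where "y = local_rep k d f"
  \<comment> \<open>This differs from a lift of f to the sphere by the orthogonal map A, which
    changes no inner product.\<close>
  define F where "F z = ?L (y z)" for z
  define N where "N z = dd ?L (\<nu> d (param k z)) (y z)" for z
  have "openin (top_of M) {q \<in> topspace (top_of M). f q \<in> fst d}"
    unfolding d_def by (rule openin_continuous_map_preimage[OF cont openin_rp_chart[OF A(1)]])
  then have "openin (top_of M) (fst k \<inter> {q \<in> topspace (top_of M). f q \<in> fst d})"
    by (rule openin_Int[OF chart_homeomorphic(2)[OF ch]])
  moreover have "fst k \<inter> {q \<in> topspace (top_of M). f q \<in> fst d} = S"
    using openin_subset[OF chart_homeomorphic(2)[OF ch]] by (auto simp: S_def)
  ultimately have U: "open U"
    unfolding U_def by (intro open_chart_image[OF ch]) (auto simp: S_def)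
  have pU: "snd k p \<in> U" using k(2) A(2) by (auto simp: U_def S_def d_def)
  have U_sub: "U \<subseteq> chart_image k" by (auto simp: U_def S_def chart_image_def)
  have inU: "param k z \<in> fst k" "f (param k z) \<in> fst d" "param k z \<in> S" "snd k (param k z) = z"
    if "z \<in> U" for z
    using that param_chart[OF ch] by (auto simp: U_def S_def)
  have S: "param k z \<in> fst k \<inter> f -` fst d" if "z \<in> U" for z using inU(3)[OF that] by (simp add: S_def)
  have y_eq: "snd d (f (param k z)) = y z" for z by (simp add: y_def local_rep_def)
  have met_N: "metric_of ?N d P u v = dd ?L u (snd d P) \<bullet> dd ?L v (snd d P)" for P u v
    by (simp add: rp_space_def)
  have sy: "smooth_on U y"
    using sm k(1) d unfolding smooth_map_def U_def S_def y_def by blast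
  have s\<nu>: "smooth_on U (\<lambda>z. \<nu> d (param k z))"
    using nu k(1) d unfolding unit_normal_field_def vector_field_along_def U_def S_def o_def by blast
  have sF: "smooth_on U F"
    unfolding F_def by (rule smooth_on_compose[OF U sy smooth_rp_lift subset_UNIV])
  have dF: "dd F u z = dd ?L (dd y u z) (y z)" if "z \<in> U" for u z
    unfolding F_def by (rule dd_compose[OF sy smooth_rp_lift that UNIV_I])
  have sN: "smooth_on U N"
    unfolding N_def using dd_apply_field(2)[OF U open_UNIV smooth_rp_lift sy s\<nu> subset_UNIV pU] .
  have diff_eq: "differential k d f (param k z) u = dd y u z" if "z \<in> U" for u z
    by (simp add: differential_def y_def inU(4)[OF that])
  have met: "metric_of M k (param k z) u v = dd F u z \<bullet> dd F v z" if "z \<in> U" for z u v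
  proof -
    have "metric_of M k (param k z) u v = metric_of ?N d (f (param k z))
        (differential k d f (param k z) u) (differential k d f (param k z) v)"
      using hs k(1) d S[OF that] unfolding hypersurface_def by blast
    then show ?thesis by (simp add: met_N y_eq diff_eq[OF that] dF[OF that])
  qed
  have bil: "bilinear (metric_of M k (param k z))"
    and pos: "u \<noteq> 0 \<Longrightarrow> metric_of M k (param k z) u u > 0" if "z \<in> U" for z u
    using rm k(1) inU(1)[OF that] unfolding riemannian_manifold_def by blast+
  have normal: "metric_of ?N d (f (param k z)) (\<nu> d (param k z)) (\<nu> d (param k z)) = 1"
    "metric_of ?N d (f (param k z)) (differential k d f (param k z) u) (\<nu> d (param k z)) = 0" if "z \<in> U" for z u
    using nu k(1) d S[OF that] unfolding unit_normal_field_def by blast+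
  have L_L: "?L z \<bullet> dd ?L u z = 0" for z u
  proof -
    have "?L z \<bullet> dd ?L u z + dd ?L u z \<bullet> ?L z = dd (\<lambda>z. ?L z \<bullet> ?L z) u z"
      by (rule dd_inner[OF smooth_rp_lift smooth_rp_lift UNIV_I, symmetric])
    then show ?thesis by (simp add: rp_lift_inner[OF c] inner_commute)
  qed
  have linear_\<eta>: "linear (\<eta> k (param k z))" if "z \<in> U" for z
    using qu k(1) inU(1)[OF that] unfolding quasi_umbilical_def one_form_def by blast
  define \<xi> where "\<xi> z = dual_field M \<eta> k (param k z)" for z
  have \<xi>: "metric_of M k (param k z) (\<xi> z) u = \<eta> k (param k z) u" if "z \<in> U" for z u
    unfolding \<xi>_def dual_field_def by (rule sharp_eq[OF bil[OF that] pos[OF that] linear_\<eta>[OF that]])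
  have norm_\<eta>: "covector_norm (metric_of M k (param k z)) (\<eta> k (param k z)) = 1" if "z \<in> U" for z
    using qu k(1) inU(1)[OF that] unfolding quasi_umbilical_def by blast
  have second: "dd (dd F v) u z \<bullet> N z = \<alpha> (param k z) * (dd F u z \<bullet> dd F v z)
      + \<beta> (param k z) * (\<eta> k (param k z) u * \<eta> k (param k z) v)" if z: "z \<in> U" for z u v
  proof -
    have "dd (dd F v) u z = dd (\<lambda>z. dd ?L (dd y v z) (y z)) u z"
      by (rule fun_cong[OF dd_cong[OF U z dF]])
    also have "\<dots> = dd ?L (dd (dd y v) u z) (y z) + dd (dd ?L (dd y v z)) (dd y u z) (y z)"
      by (rule dd_apply_field(1)[OF U open_UNIV smooth_rp_lift sy smooth_on_dd[OF sy] subset_UNIV z])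
    finally have "dd (dd F v) u z \<bullet> N z = dd ?L (dd (dd y v) u z) (y z) \<bullet> N z
        + dd (dd ?L (dd y v z)) (dd y u z) (y z) \<bullet> N z"
      by (simp add: inner_add_left)
    \<comment> \<open>N is tangent to the image of the lift, so only the tangential part of the
      second derivative counts, and that is the Christoffel term of projective space.\<close>
    also have "dd (dd ?L (dd y v z)) (dd y u z) (y z) \<bullet> N z
        = dd ?L (christoffel (local_metric ?N d) (y z) (dd y u z) (dd y v z)) (y z) \<bullet> N z"
      unfolding N_def
      by (rule christoffel_immersion[OF open_UNIV smooth_rp_lift UNIV_I rp_lift_immersion[OF c]
            local_metric_rp_space[OF c d], symmetric])
    also have "dd ?L (dd (dd y v) u z) (y z) \<bullet> N z
        + dd ?L (christoffel (local_metric ?N d) (y z) (dd y u z) (dd y v z)) (y z) \<bullet> N z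
        = second_form ?N k d f \<nu> (param k z) u v"
      unfolding second_form_def diff_eq[OF z] inU(4)[OF z] met_N y_eq y_def[symmetric] N_def
      by (simp only: linear_add[OF linear_dd_smooth[OF smooth_rp_lift UNIV_I]] inner_add_left)
    also have "\<dots> = \<alpha> (param k z) * metric_of M k (param k z) u v
        + \<beta> (param k z) * (\<eta> k (param k z) u * \<eta> k (param k z) v)"
      using qu k(1) d S[OF z] unfolding quasi_umbilical_def second_fundamental_form_def by metis
    finally show ?thesis by (simp add: met[OF z])
  qed
  have "quasi_umbilical_patch U F N c (\<lambda>z. \<alpha> (param k z)) (\<lambda>z. \<beta> (param k z)) (\<lambda>z. \<eta> k (param k z)) \<xi>"
  proof
    show "DIM((real^'k) \<times> real) = DIM(real^'n) + 2" using hs by (simp add: hypersurface_def)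
    show "DIM(real^'n) > 2" using n by simp
    show "F z \<bullet> F z = 1 / c" for z by (simp add: F_def rp_lift_inner[OF c])
    show "N z \<bullet> N z = 1" if "z \<in> U" for z
      using normal(1)[OF that] by (simp add: met_N N_def y_eq)
    show "N z \<bullet> F z = 0" for z using L_L[of "y z"] by (simp add: N_def F_def inner_commute)
    show "N z \<bullet> dd F u z = 0" if "z \<in> U" for z u
      using normal(2)[OF that, of u] by (simp add: met_N N_def y_eq diff_eq[OF that] dF[OF that] inner_commute)
    show "u = 0" if "z \<in> U" "dd F u z = 0" for z u
      using pos[OF that(1), of u] met[OF that(1), of u u] that(2) by auto
    show "smooth_on U (\<lambda>z. \<alpha> (param k z))" "smooth_on U (\<lambda>z. \<beta> (param k z))"
      using qu k(1) smooth_on_subset[OF _ U_sub]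
      unfolding quasi_umbilical_def smooth_function_def o_def by blast+
    show "smooth_on U (\<lambda>z. \<eta> k (param k z) u)" for u
      using qu k(1) smooth_on_subset[OF _ U_sub] unfolding quasi_umbilical_def one_form_def by blast
    show "\<eta> k (param k z) (a + b) = \<eta> k (param k z) a + \<eta> k (param k z) b" if "z \<in> U" for z a b
      by (rule linear_add[OF linear_\<eta>[OF that]])
    show "\<eta> k (param k z) (r *\<^sub>R b) = r *\<^sub>R \<eta> k (param k z) b" if "z \<in> U" for z r b
      by (rule linear_cmul[OF linear_\<eta>[OF that]])
    show "dd F (\<xi> z) z \<bullet> dd F u z = \<eta> k (param k z) u" if "z \<in> U" for z u
      using \<xi>[OF that] met[OF that] by simp
    show "\<eta> k (param k z) (\<xi> z) = 1" if "z \<in> U" for z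
      using norm_\<eta>[OF that] \<xi>[OF that, of "\<xi> z"]
      by (simp add: covector_norm_def \<xi>_def dual_field_def)
  qed (fact U sF sN c second)+
  then show thesis
    unfolding \<xi>_def[abs_def] by (rule that[OF k U pU U_sub _ met])
qed

section \<open>The sign of the soliton constant\<close>

lemma ricci_soliton_negative:
  fixes M :: "('m, 'n::finite) rmfd" and f :: "'m \<Rightarrow> ((real^'k::finite) \<times> real) set"
  assumes n: "CARD('n) > 2" and c: "c > 0" and hs: "hypersurface M (rp_space c) f"
    and nu: "unit_normal_field M (rp_space c) f \<nu>"
    and qu: "quasi_umbilical M (rp_space c) f \<nu> \<alpha> \<beta> \<eta>"
    and \<alpha>\<beta>: "\<forall>p\<in>topspace (top_of M). \<alpha> p * \<beta> p > 0"
    and sol: "ricci_soliton M (dual_field M \<eta>) lam"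
  shows "lam < 0"
proof -
  have M: "smooth_manifold M" using hs by (simp add: hypersurface_def riemannian_manifold_def)
  \<comment> \<open>\<open>lam\<close> is a constant, so a single point determines its sign.\<close>
  then obtain p where p: "p \<in> topspace (top_of M)" unfolding smooth_manifold_def by blast
  obtain k U and F N :: "real^'n \<Rightarrow> (real^'k) \<times> real"
    where k: "k \<in> atlas_of M" "p \<in> fst k" and U: "open U" "snd k p \<in> U" "U \<subseteq> chart_image k"
    and patch: "quasi_umbilical_patch U F N c (\<lambda>z. \<alpha> (param k z)) (\<lambda>z. \<beta> (param k z)) (\<lambda>z. \<eta> k (param k z))
      (\<lambda>z. dual_field M \<eta> k (param k z))"
    and met: "\<And>z u v. z \<in> U \<Longrightarrow> metric_of M k (param k z) u v = dd F u z \<bullet> dd F v z"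
    by (rule hypersurface_patch[OF n c hs nu qu p]) blast
  define V where "V z = dual_field M \<eta> k (param k z)" for z
  define x where "x = snd k p"
  interpret quasi_umbilical_patch U F N c "\<lambda>z. \<alpha> (param k z)" "\<lambda>z. \<beta> (param k z)" "\<lambda>z. \<eta> k (param k z)" V
    using patch unfolding V_def[abs_def] .
  have x: "x \<in> U" using U(2) by (simp add: x_def)
  have G: "local_metric M k z u v = dd F u z \<bullet> dd F v z" if "z \<in> U" for z u v
    using met[OF that] by (simp add: local_metric_def)
  have V: "smooth_on U V"
    by (rule smooth_on_tangent_component[OF open_U smooth_F dF_inj dF_\<xi> smooth_\<eta>])
  have unit: "local_metric M k z (V z) (V z) = 1" if "z \<in> U" for z
    using G[OF that] dF_\<xi>[OF that] \<eta>_\<xi>[OF that] by simp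
  have "lie_derivative V (local_metric M k) (\<lambda>_. V x) (\<lambda>_. V x) x
      + 2 * ricci (local_metric M k) (\<lambda>_. V x) (\<lambda>_. V x) x
      + 2 * lam * local_metric M k x (V x) (V x) = 0"
    using sol k(1) x U(3) smooth_on_const unfolding ricci_soliton_def V_def by blast
  moreover have "lie_derivative V (local_metric M k) (\<lambda>_. V x) (\<lambda>_. V x) x = 0"
    by (rule lie_derivative_unit_field[OF open_U smooth_F V x G unit])
  moreover have "ricci (local_metric M k) (\<lambda>_. V x) (\<lambda>_. V x) x
      = (c + \<alpha> (param k x) * (\<alpha> (param k x) + \<beta> (param k x))) * (real CARD('n) - 1)"
    by (rule ricci_dual_field[OF quasi_umbilical_patch_axioms x G])
  moreover have "param k x = p"
    unfolding x_def by (rule param_chart[OF manifold_charts(1)[OF M k(1)] k(2)])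
  ultimately have "lam = - ((c + \<alpha> p * \<alpha> p + \<alpha> p * \<beta> p) * (real CARD('n) - 1))"
    using unit[OF x] by (simp add: algebra_simps)
  moreover have "c + \<alpha> p * \<alpha> p + \<alpha> p * \<beta> p > 0"
    using c bspec[OF \<alpha>\<beta> p] by (simp add: add_pos_nonneg add_pos_pos)
  ultimately show ?thesis using n by simp
qed

section \<open>Non-compactness\<close>

text \<open>The transverse direction is the value of \<open>\<xi>\<close> at x, frozen to a
  constant: \<open>\<eta>\<close> takes the value 1 on it at x and stays positive nearby.\<close>

lemma focal_patch_restrict:
  assumes patch: "quasi_umbilical_patch U F N c \<alpha> \<beta> \<eta> \<xi>" and x: "x \<in> U" "\<alpha> x > 0"
    and \<alpha>\<beta>: "\<And>z. z \<in> U \<Longrightarrow> \<alpha> z * \<beta> z > 0"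
  obtains W where "x \<in> W" "W \<subseteq> U" "focal_patch W F N c \<alpha> \<beta> \<eta> \<xi> (\<xi> x)"
proof -
  interpret quasi_umbilical_patch U F N c \<alpha> \<beta> \<eta> \<xi> by fact
  define W where "W = (U \<inter> \<alpha> -` {0<..}) \<inter> (U \<inter> (\<lambda>z. \<eta> z (\<xi> x)) -` {0<..})"
  have "open W"
    unfolding W_def
    by (intro open_Int continuous_open_preimage smooth_on_continuous smooth_\<alpha> smooth_\<eta> open_U
        open_greaterThan)
  then have "quasi_umbilical_patch W F N c \<alpha> \<beta> \<eta> \<xi>"
    by (rule quasi_umbilical_patch_subset[OF patch]) (auto simp: W_def)
  moreover have "\<alpha> z > 0" "\<beta> z > 0" "\<eta> z (\<xi> x) > 0" if "z \<in> W" for z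
    using that \<alpha>\<beta>[of z] by (auto simp: W_def zero_less_mult_iff)
  ultimately have "focal_patch W F N c \<alpha> \<beta> \<eta> \<xi> (\<xi> x)"
    by (simp add: focal_patch_def focal_patch_axioms_def)
  moreover have "x \<in> W" using x \<eta>_\<xi>[OF x(1)] by (simp add: W_def)
  ultimately show thesis using that[of W] by (auto simp: W_def)
qed

text \<open>Absolute values make the penalized function insensitive to the choice of normal, so the
  signs can be normalised separately near each point while the function stays global.\<close>

lemma no_minimum_in_neighbourhood:
  fixes M :: "('m, 'n::finite) rmfd" and f :: "'m \<Rightarrow> ((real^'k::finite) \<times> real) set"
  assumes n: "CARD('n) > 2" and c: "c > 0" and hs: "hypersurface M (rp_space c) f"
    and nu: "unit_normal_field M (rp_space c) f \<nu>"
    and qu: "quasi_umbilical M (rp_space c) f \<nu> \<alpha> \<beta> \<eta>"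
    and \<alpha>\<beta>: "\<forall>p\<in>topspace (top_of M). \<alpha> p * \<beta> p > 0" and p: "p \<in> topspace (top_of M)"
  obtains B \<delta> where "openin (top_of M) B" "p \<in> B" "\<delta> > 0"
    "\<And>e q. 0 < e \<Longrightarrow> e < \<delta> \<Longrightarrow> q \<in> B \<Longrightarrow>
      \<exists>r\<in>topspace (top_of M). \<bar>\<alpha> r\<bar> + e * inverse \<bar>\<beta> r\<bar> < \<bar>\<alpha> q\<bar> + e * inverse \<bar>\<beta> q\<bar>"
proof -
  have M: "smooth_manifold M" using hs by (simp add: hypersurface_def riemannian_manifold_def)
  obtain k U and F N :: "real^'n \<Rightarrow> (real^'k) \<times> real"
    where k: "k \<in> atlas_of M" "p \<in> fst k" and U: "open U" "snd k p \<in> U" "U \<subseteq> chart_image k"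
    and patch: "quasi_umbilical_patch U F N c (\<lambda>z. \<alpha> (param k z)) (\<lambda>z. \<beta> (param k z)) (\<lambda>z. \<eta> k (param k z))
      (\<lambda>z. dual_field M \<eta> k (param k z))"
    by (rule hypersurface_patch[OF n c hs nu qu p]) blast
  note ch = manifold_charts(1)[OF M k(1)]
  have in_top: "param k z \<in> topspace (top_of M)" if "z \<in> U" for z
    using chart_param(1)[of z k] U(3) that openin_subset[OF chart_homeomorphic(2)[OF ch]] by blast
  define x where "x = snd k p"
  have x: "x \<in> U" "param k x = p" using U(2) param_chart[OF ch k(2)] by (simp_all add: x_def)
  \<comment> \<open>Reversing the normal changes the signs of both \<open>\<alpha>\<close> and \<open>\<beta>\<close>.\<close>
  obtain s N' where s: "s = 1 \<or> s = -1" "s * \<alpha> p > 0"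
    and patch': "quasi_umbilical_patch U F N' c (\<lambda>z. s * \<alpha> (param k z)) (\<lambda>z. s * \<beta> (param k z))
      (\<lambda>z. \<eta> k (param k z)) (\<lambda>z. dual_field M \<eta> k (param k z))"
  proof (cases "\<alpha> p > 0")
    case True
    then show thesis using that[of 1 N] patch by simp
  next
    case False
    moreover have "\<alpha> p \<noteq> 0" using bspec[OF \<alpha>\<beta> p] by auto
    ultimately show thesis
      using that[of "-1" "\<lambda>x. - N x"] quasi_umbilical_patch_uminus[OF patch] by simp
  qed
  have "s * \<alpha> (param k z) * (s * \<beta> (param k z)) > 0" if "z \<in> U" for z
    using bspec[OF \<alpha>\<beta> in_top[OF that]] s(1) by auto
  then obtain W where W: "x \<in> W" "W \<subseteq> U"
    and "focal_patch W F N' c (\<lambda>z. s * \<alpha> (param k z)) (\<lambda>z. s * \<beta> (param k z))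
      (\<lambda>z. \<eta> k (param k z)) (\<lambda>z. dual_field M \<eta> k (param k z)) (dual_field M \<eta> k (param k x))"
    using focal_patch_restrict[OF patch' x(1)] s(2) x(2) by blast
  then interpret focal_patch W F N' c "\<lambda>z. s * \<alpha> (param k z)" "\<lambda>z. s * \<beta> (param k z)"
    "\<lambda>z. \<eta> k (param k z)" "\<lambda>z. dual_field M \<eta> k (param k z)" "dual_field M \<eta> k (param k x)" by simp
  have abs: "\<bar>\<alpha> (param k z)\<bar> = s * \<alpha> (param k z)" "\<bar>\<beta> (param k z)\<bar> = s * \<beta> (param k z)" if "z \<in> W" for z
    using \<alpha>_pos[OF that] \<beta>_pos[OF that] s(1) by auto
  obtain V \<delta> where V: "open V" "x \<in> V" "V \<subseteq> W" "\<delta> > 0" and min: "\<And>e z. 0 < e \<Longrightarrow> e < \<delta> \<Longrightarrow> z \<in> V \<Longrightarrow>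
      \<exists>y\<in>W. s * \<alpha> (param k y) + e * inverse (s * \<beta> (param k y))
        < s * \<alpha> (param k z) + e * inverse (s * \<beta> (param k z))"
    using no_minimum_nearby[OF W(1)] by blast
  show thesis
  proof (rule that)
    show "openin (top_of M) {q \<in> fst k. snd k q \<in> V}" by (rule openin_chart_preimage[OF ch V(1)])
    show "p \<in> {q \<in> fst k. snd k q \<in> V}" using k(2) V(2) by (simp add: x_def)
    fix e q assume e: "0 < e" "e < \<delta>" and q: "q \<in> {q \<in> fst k. snd k q \<in> V}"
    then have "snd k q \<in> V" "param k (snd k q) = q" using param_chart[OF ch] by auto
    with min[OF e, of "snd k q"] abs[of "snd k q"] V(3) obtain y where y: "y \<in> W"
      "s * \<alpha> (param k y) + e * inverse (s * \<beta> (param k y)) < \<bar>\<alpha> q\<bar> + e * inverse \<bar>\<beta> q\<bar>"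
      by auto
    then show "\<exists>r\<in>topspace (top_of M). \<bar>\<alpha> r\<bar> + e * inverse \<bar>\<beta> r\<bar> < \<bar>\<alpha> q\<bar> + e * inverse \<bar>\<beta> q\<bar>"
      using abs[OF y(1)] in_top[of y] W(2) by (intro bexI[of _ "param k y"]) auto
  qed (rule V(4))
qed

text \<open>Each point has its own bound on e. Compactness serves twice: a finite subcover gives one
  e admissible everywhere, and the function for this e attains its minimum.\<close>

lemma quasi_umbilical_not_compact:
  fixes M :: "('m, 'n::finite) rmfd" and f :: "'m \<Rightarrow> ((real^'k::finite) \<times> real) set"
  assumes n: "CARD('n) > 2" and c: "c > 0" and hs: "hypersurface M (rp_space c) f"
    and nu: "unit_normal_field M (rp_space c) f \<nu>"
    and qu: "quasi_umbilical M (rp_space c) f \<nu> \<alpha> \<beta> \<eta>"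
    and \<alpha>\<beta>: "\<forall>p\<in>topspace (top_of M). \<alpha> p * \<beta> p > 0"
  shows "\<not> compact_space (top_of M)"
proof
  assume compact: "compact_space (top_of M)"
  have M: "smooth_manifold M" using hs by (simp add: hypersurface_def riemannian_manifold_def)
  let ?T = "topspace (top_of M)"
  define \<Phi> where "\<Phi> e p = \<bar>\<alpha> p\<bar> + e * inverse \<bar>\<beta> p\<bar>" for e p
  define P where "P B \<delta> \<longleftrightarrow> \<delta> > 0 \<and> (\<forall>e q. 0 < e \<and> e < \<delta> \<and> q \<in> B \<longrightarrow> (\<exists>r\<in>?T. \<Phi> e r < \<Phi> e q))" for B \<delta>
  have "\<exists>B. openin (top_of M) B \<and> p \<in> B \<and> (\<exists>\<delta>. P B \<delta>)" if "p \<in> ?T" for p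
    by (rule no_minimum_in_neighbourhood[OF n c hs nu qu \<alpha>\<beta> that]) (unfold P_def \<Phi>_def, blast)
  then have "\<forall>B\<in>{B. openin (top_of M) B \<and> (\<exists>\<delta>. P B \<delta>)}. openin (top_of M) B"
    "?T \<subseteq> \<Union>{B. openin (top_of M) B \<and> (\<exists>\<delta>. P B \<delta>)}" by blast+
  then obtain \<B> where \<B>: "finite \<B>" "\<B> \<subseteq> {B. openin (top_of M) B \<and> (\<exists>\<delta>. P B \<delta>)}" "?T \<subseteq> \<Union>\<B>"
    using compact unfolding compact_space_alt by meson
  then have "\<forall>B\<in>\<B>. \<exists>\<delta>. P B \<delta>" by blast
  then obtain \<delta> where \<delta>: "\<And>B. B \<in> \<B> \<Longrightarrow> P B (\<delta> B)" by metis
  \<comment> \<open>The element 1 keeps the set nonempty, and halving makes e strictly smaller than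
    every bound.\<close>
  define e where "e = Min (insert 1 (\<delta> ` \<B>)) / 2"
  have "Min (insert 1 (\<delta> ` \<B>)) > 0" using \<B>(1) \<delta> by (auto simp: P_def)
  moreover have "Min (insert 1 (\<delta> ` \<B>)) \<le> \<delta> B" if "B \<in> \<B>" for B using \<B>(1) that by simp
  ultimately have e: "0 < e" "\<And>B. B \<in> \<B> \<Longrightarrow> e < \<delta> B" by (auto simp: e_def) (smt (verit) field_sum_of_halves)
  have "continuous_map (top_of M) euclideanreal \<alpha>" "continuous_map (top_of M) euclideanreal \<beta>"
    using qu continuous_map_smooth_function[OF M] by (auto simp: quasi_umbilical_def)
  then have "continuous_map (top_of M) euclideanreal (\<Phi> e)"
    unfolding \<Phi>_def[abs_def] using \<alpha>\<beta>
    by (intro continuous_map_add continuous_map_real_mult continuous_map_real_inverse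
        continuous_map_real_abs) auto
  then have "compact (\<Phi> e ` ?T)"
    using image_compactin compact unfolding compact_space_def by (metis compactin_euclidean_iff)
  moreover have "?T \<noteq> {}" using M unfolding smooth_manifold_def by blast
  ultimately obtain p where p: "p \<in> ?T" "\<And>q. q \<in> ?T \<Longrightarrow> \<Phi> e p \<le> \<Phi> e q"
    using compact_attains_inf[of "\<Phi> e ` ?T"] by blast
  then obtain B where "B \<in> \<B>" "p \<in> B" using \<B>(3) by blast
  then obtain q where "q \<in> ?T" "\<Phi> e q < \<Phi> e p" using \<delta> e unfolding P_def by blast
  then show False using p(2) by fastforce
qed

theorem mainTheorem4:
  fixes M :: "('m, 'n::finite) rmfd"
    and c :: real
    and f :: "'m \<Rightarrow> ((real^'k::finite) \<times> real) set"
    and \<nu> :: "(((real^'k) \<times> real) set, 'k) chart \<Rightarrow> 'm \<Rightarrow> real^'k"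
    and \<alpha> \<beta> :: "'m \<Rightarrow> real"
    and \<eta> :: "('m, 'n) chart \<Rightarrow> 'm \<Rightarrow> real^'n \<Rightarrow> real"
  assumes "CARD('n) > 2"
    and "CARD('k) = CARD('n) + 1"
    and "c > 0"
    and "hypersurface M (rp_space c) f"
    and "orientable M"
    and "unit_normal_field M (rp_space c) f \<nu>"
    and "quasi_umbilical M (rp_space c) f \<nu> \<alpha> \<beta> \<eta>"
    and "\<forall>p\<in>topspace (top_of M). \<alpha> p * \<beta> p > 0"
  shows "(\<forall>lam. ricci_soliton M (dual_field M \<eta>) lam \<longrightarrow> lam < 0) \<and>
         (compact_space (top_of M) \<longrightarrow> real_homology_sphere CARD('n) (top_of M))"
  using ricci_soliton_negative[OF assms(1,3,4,6,7,8)] quasi_umbilical_not_compact[OF assms(1,3,4,6,7,8)]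
  by blast

end
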